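(* Let $n\ge 3$ be an integer, let $l,r$ be nonzero complex numbers, $m=\frac1r-r$ and $F=\mathbb{Q}(l,r)$, and assume that $(r^2)^k\neq 1$ for every $k\in\{1,\dots,n\}$. Let $\nu^{(n)}$ be the Lawrence-Krammer representation of the BMW algebra $B(A_{n-1})$ with parameters $l$ and $m$ on the $F$-vector space $\mathcal V^{(n)}$. (1) If $n\ge 4$, then $\nu^{(n)}$ is irreducible, except when $l\in\{r,\,-r^3,\,\frac{1}{r^{n-3}},\,-\frac{1}{r^{n-3}},\,\frac{1}{r^{2n-3}}\}$, when it is reducible. (2) If $n=3$, then $\nu^{(3)}$ is irreducible, except when $l\in\{-r^3,\,\frac1{r^3},\,1,\,-1\}$, when it is reducible.
   Context: Let $l,r$ be nonzero complex numbers with $r^2\ne1$, $m=\frac1r-r$ and $F=\mathbb{Q}(l,r)\subset\mathbb{C}$. The BMW algebra $B(A_{n-1})$ is the unital associative $F$-algebra generated by invertible elements $g_1,\dots,g_{n-1}$, with $e_i:=\frac{l}{m}(g_i^2+m g_i-1)$, subject to: $g_ig_j=g_jg_i$ for $|i-j|\ge2$; $g_ig_{i+1}g_i=g_{i+1}g_ig_{i+1}$; $g_ie_i=l^{-1}e_i$; $e_ig_{i+1}e_i=l e_i$; $e_ig_{i-1}e_i=l e_i$ (whenever the indices make sense). The Lawrence-Krammer space $\mathcal V^{(n)}$ is the $F$-vector space with basis $\{w_{ij}:1\le i<j\le n\}$ (dimension $\frac{n(n-1)}2$). The Lawrence-Krammer representation $\nu^{(n)}:B(A_{n-1})\to \mathrm{End}_F(\mathcal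 V^{(n)})$ sends $g_k$ to the endomorphism $\nu_k$ defined, for $1\le k\le n-1$, by: - $\nu_k(w_{ij})=r\,w_{ij}$ if $\{i,j\}\cap\{k,k+1\}=\emptyset$; - $\nu_k(w_{k,k+1})=l^{-1}w_{k,k+1}$; - $\nu_k(w_{k,j})=w_{k+1,j}$ for $j\ge k+2$; - $\nu_k(w_{k+1,j})=w_{k,j}+m\,r^{j-k-2}\,w_{k,k+1}-m\,w_{k+1,j}$ for $j\ge k+2$; - $\nu_k(w_{i,k})=w_{i,k+1}$ for $i\le k-1$; - $\nu_k(w_{i,k+1})=w_{i,k}+\frac{m}{l\,r^{k-1-i}}\,w_{k,k+1}-m\,w_{i,k+1}$ for $i\le k-1$. Irreducible means that there is no $F$-subspace other than $0$ and $\mathcal V^{(n)}$ stable under $B(A_{n-1})$; reducible means not irreducible. *)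

theory Defs
  imports
    "HOL-Algebra.Algebraic_Closure_Type"
    "HOL-Algebra.Generated_Fields"
    "HOL-Algebra.QuotRing"
    "HOL-Algebra.Module"
    "HOL-Library.Poly_Mapping"
    Complex_Main
begin

section \<open>The ground field\<close>

definition bmw_m :: "complex \<Rightarrow> complex" where
  "bmw_m r = 1 / r - r"

definition ground_set :: "complex \<Rightarrow> complex \<Rightarrow> complex set" where
  "ground_set l r = generate_field (ring_of_type_algebra :: complex ring) {l, r}"

definition ground_field :: "complex \<Rightarrow> complex \<Rightarrow> complex ring" where
  "ground_field l r = ring_of_type_algebra\<lparr>carrier := ground_set l r\<rparr>"


section \<open>The free algebra on the generators and their formal inverses\<close>

datatype letter = Gen nat | GenInv nat

fun letter_index :: "letter \<Rightarrow> nat" where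
  "letter_index (Gen k) = k"
| "letter_index (GenInv k) = k"

text \<open>The free monoid on the letters, written additively, because the product that
  \<^theory>\<open>HOL-Library.Poly_Mapping\<close> puts on finitely supported functions
  is the convolution with respect to addition of the exponents.\<close>

datatype word = Word (letters: "letter list")

instantiation word :: monoid_add
begin
definition zero_word :: word where "0 = Word []"
definition plus_word :: "word \<Rightarrow> word \<Rightarrow> word" where
  "u + v = Word (letters u @ letters v)"
instance by standard (simp_all add: zero_word_def plus_word_def)
end

definition free_algebra :: "nat \<Rightarrow> complex \<Rightarrow> complex \<Rightarrow> (word \<Rightarrow>\<^sub>0 complex) ring" where
  "free_algebra n l r = ring_of_type_algebra\<lparr>carrier :=
     {p. (\<forall>w. Poly_Mapping.lookup p w \<in> ground_set l r) \<and>
         (\<forall>w \<in> Poly_Mapping.keys p. \<forall>x \<in> set (letters w). letter_index x \<in> {1..n - 1})}\<rparr>"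

definition scal :: "complex \<Rightarrow> (word \<Rightarrow>\<^sub>0 complex)" where
  "scal c = Poly_Mapping.single 0 c"

definition gen :: "nat \<Rightarrow> (word \<Rightarrow>\<^sub>0 complex)" where
  "gen k = Poly_Mapping.single (Word [Gen k]) 1"

definition gen_inv :: "nat \<Rightarrow> (word \<Rightarrow>\<^sub>0 complex)" where
  "gen_inv k = Poly_Mapping.single (Word [GenInv k]) 1"

definition e_elem :: "complex \<Rightarrow> complex \<Rightarrow> nat \<Rightarrow> (word \<Rightarrow>\<^sub>0 complex)" where
  "e_elem l r i = scal (l / bmw_m r) * (gen i ^ 2 + scal (bmw_m r) * gen i - 1)"


section \<open>The BMW algebra of type \<open>A\<^bsub>n-1\<^esub>\<close>\<close>

definition bmw_relators :: "nat \<Rightarrow> complex \<Rightarrow> complex \<Rightarrow> (word \<Rightarrow>\<^sub>0 complex) set" where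
  "bmw_relators n l r =
     {gen i * gen_inv i - 1 | i. i \<in> {1..n - 1}}
   \<union> {gen_inv i * gen i - 1 | i. i \<in> {1..n - 1}}
   \<union> {gen i * gen j - gen j * gen i | i j.
        i \<in> {1..n - 1} \<and> j \<in> {1..n - 1} \<and> (i + 2 \<le> j \<or> j + 2 \<le> i)}
   \<union> {gen i * gen (i + 1) * gen i - gen (i + 1) * gen i * gen (i + 1) | i.
        i \<in> {1..n - 1} \<and> i + 1 \<in> {1..n - 1}}
   \<union> {gen i * e_elem l r i - scal (inverse l) * e_elem l r i | i. i \<in> {1..n - 1}}
   \<union> {e_elem l r i * gen (i + 1) * e_elem l r i - scal l * e_elem l r i | i.
        i \<in> {1..n - 1} \<and> i + 1 \<in> {1..n - 1}}
   \<union> {e_elem l r i * gen (i - 1) * e_elem l r i - scal l * e_elem l r i | i.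
        i \<in> {1..n - 1} \<and> i - 1 \<in> {1..n - 1}}"

definition bmw_algebra :: "nat \<Rightarrow> complex \<Rightarrow> complex \<Rightarrow> (word \<Rightarrow>\<^sub>0 complex) set ring" where
  "bmw_algebra n l r =
     free_algebra n l r Quot genideal (free_algebra n l r) (bmw_relators n l r)"


section \<open>The Lawrence-Krammer space\<close>

type_synonym lk_vec = "(nat \<times> nat) \<Rightarrow>\<^sub>0 complex"

definition lk_w :: "nat \<Rightarrow> nat \<Rightarrow> lk_vec" where
  "lk_w i j = Poly_Mapping.single (i, j) 1"

definition lk_scale :: "complex \<Rightarrow> lk_vec \<Rightarrow> lk_vec" where
  "lk_scale c v = Poly_Mapping.map ((*) c) v"

text \<open>The fields \<^term>\<open>mult\<close> and \<^term>\<open>one\<close> of a module record carry no meaning and are left unspecified.\<close>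

definition lk_space :: "nat \<Rightarrow> complex \<Rightarrow> complex \<Rightarrow> (complex, lk_vec) module" where
  "lk_space n l r =
     \<lparr>carrier = {v. (\<forall>p. Poly_Mapping.lookup v p \<in> ground_set l r) \<and>
                    Poly_Mapping.keys v \<subseteq> {(i, j). 1 \<le> i \<and> i < j \<and> j \<le> n}},
      monoid.mult = undefined, one = undefined,
      ring.zero = 0, add = (+), module.smult = lk_scale\<rparr>"


section \<open>The Lawrence-Krammer representation\<close>

text \<open>The image of \<open>w\<^bsub>ij\<^esub>\<close> under \<open>\<nu>\<^bsub>k\<^esub>\<close>, for \<open>i < j\<close>. Under this assumption the successive
  conditions leave exactly the ranges \<open>j \<ge> k + 2\<close>, \<open>j \<ge> k + 2\<close>, \<open>i \<le> k - 1\<close>, \<open>i \<le> k - 1\<close>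
  in the last four branches, so no subtraction in an exponent truncates.\<close>

definition nu_basis :: "complex \<Rightarrow> complex \<Rightarrow> nat \<Rightarrow> nat \<Rightarrow> nat \<Rightarrow> lk_vec" where
  "nu_basis l r k i j =
     (if {i, j} \<inter> {k, k + 1} = {} then lk_scale r (lk_w i j)
      else if i = k \<and> j = k + 1 then lk_scale (inverse l) (lk_w k (k + 1))
      else if i = k then lk_w (k + 1) j
      else if i = k + 1 then
        lk_w k j + lk_scale (bmw_m r * r ^ (j - k - 2)) (lk_w k (k + 1))
          - lk_scale (bmw_m r) (lk_w (k + 1) j)
      else if j = k then lk_w i (k + 1)
      else
        lk_w i k + lk_scale (bmw_m r / (l * r ^ (k - 1 - i))) (lk_w k (k + 1))
          - lk_scale (bmw_m r) (lk_w i (k + 1)))"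

definition nu :: "complex \<Rightarrow> complex \<Rightarrow> nat \<Rightarrow> lk_vec \<Rightarrow> lk_vec" where
  "nu l r k v =
     (\<Sum>(i, j) \<in> Poly_Mapping.keys v. lk_scale (Poly_Mapping.lookup v (i, j)) (nu_basis l r k i j))"

fun letter_action :: "nat \<Rightarrow> complex \<Rightarrow> complex \<Rightarrow> letter \<Rightarrow> lk_vec \<Rightarrow> lk_vec" where
  "letter_action n l r (Gen k) = nu l r k"
| "letter_action n l r (GenInv k) = inv_into (carrier (lk_space n l r)) (nu l r k)"

definition word_action :: "nat \<Rightarrow> complex \<Rightarrow> complex \<Rightarrow> word \<Rightarrow> lk_vec \<Rightarrow> lk_vec" where
  "word_action n l r w = foldr (letter_action n l r) (letters w)"

definition free_action ::
    "nat \<Rightarrow> complex \<Rightarrow> complex \<Rightarrow> (word \<Rightarrow>\<^sub>0 complex) \<Rightarrow> lk_vec \<Rightarrow> lk_vec" where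
  "free_action n l r p v =
     (\<Sum>w \<in> Poly_Mapping.keys p. lk_scale (Poly_Mapping.lookup p w) (word_action n l r w v))"

text \<open>An element of the BMW algebra is a coset; it acts on the Lawrence-Krammer space through
  the common action of all its representatives in the free algebra.\<close>

definition lk_rep ::
    "nat \<Rightarrow> complex \<Rightarrow> complex \<Rightarrow> (word \<Rightarrow>\<^sub>0 complex) set \<Rightarrow> lk_vec \<Rightarrow> lk_vec" where
  "lk_rep n l r x v = the_elem ((\<lambda>p. free_action n l r p v) ` x)"


section \<open>Irreducibility\<close>

definition irreducible_rep ::
    "('k, 'c) ring_scheme \<Rightarrow> ('k, 'v, 'd) module_scheme \<Rightarrow> ('a, 'b) ring_scheme
       \<Rightarrow> ('a \<Rightarrow> 'v \<Rightarrow> 'v) \<Rightarrow> bool" where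
  "irreducible_rep K V A \<rho> \<longleftrightarrow>
     (\<forall>W. submodule W K V \<and> (\<forall>x \<in> carrier A. \<forall>v \<in> W. \<rho> x v \<in> W)
        \<longrightarrow> W = {\<zero>\<^bsub>V\<^esub>} \<or> W = carrier V)"

definition lk_irreducible :: "nat \<Rightarrow> complex \<Rightarrow> complex \<Rightarrow> bool" where
  "lk_irreducible n l r \<longleftrightarrow>
     irreducible_rep (ground_field l r) (lk_space n l r) (bmw_algebra n l r) (lk_rep n l r)"

end

theory Submission
  imports Defs
begin

text \<open>
  Write $x = 1/l$ and $m = 1/r - r$. On the coordinates $a_{ij}$ of a vector, $\nu_k$ acts locally,
  except for the coordinate $(k, k+1)$. Everything becomes local after adjoining the functionals
  $f_i = \sum_{j>i} r^j a_{ij} + x r^3 \sum_{j<i} r^j a_{ji}$, because $\nu_k$ maps the pair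
  (coordinates, functionals) to an expression in the same quantities at $k$ and $k+1$. This gives
  the braid relations, and $\nu_k^2 + m \nu_k - 1 = m\, \varepsilon_k(\cdot)\, w_{k,k+1}$ for a
  functional $\varepsilon_k$.

  A stable subspace containing some $w_{k,k+1}$ is everything, so on a proper stable subspace $W$ all
  $\varepsilon_k$ vanish. If $\nu_1 = r$ on $W$, then all $\nu_k = r$ on $W$ (braid relation), $W$ is spanned
  by $\sum r^{i+j} w_{ij}$ and $l = 1/r^{2n-3}$. Otherwise $u = (\nu_1 - r) v \neq 0$ for some $v \in W$;
  it is supported on the pairs meeting $\{1, 2\}$ and satisfies $\nu_1 u = -u/r$. Then $(\nu_j - r) u$ is a multiple
  of $y_j = w_{1j} - w_{1,j+1}/r - w_{2j}/r + w_{2,j+1}/r^2$. Either some $y_j$ lies in $W$, and then so does $y_3$, and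
  $\varepsilon_2(y_3) = 0$ reads $(l - r)(l + r^3) = 0$; or $u$ is determined up to a scalar, and
  $\varepsilon_2(u) = 0$ reads $(l + r^3)(l^2 r^{2n-6} - 1) = 0$.

  Conversely, the common kernel of the $f_i$ is stable if $l \in \{r, -r^3\}$, and the vectors
  $a_{ij} = r^i t_j + (l/r^3) r^j t_i$ with $\sum r^i t_i = 0$ form a stable subspace if $l^2 r^{2n-6} = 1$.
\<close>

section \<open>Coefficients and coordinates\<close>

text \<open>The representation is given on cosets through \<open>the_elem\<close>, with formal
  inverses read as \<open>inv_into\<close>. Both disappear once the relators are known to act as
  zero and \<open>nu_k\<close> is known to satisfy a cubic with nonzero constant term: its inverse
  is then a polynomial in \<open>nu_k\<close>, and stability under the BMW algebra becomes stability
  of an F-subspace under \<open>nu_1, ..., nu_{n-1}\<close>. The weights of the functionals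
  \<open>f_i\<close> come from the one nonlocal coordinate. The coefficient of
  \<open>w_{k,k+1}\<close> in \<open>nu_k v\<close> collects \<open>m r^{j-k-2} a_{k+1,j}\<close>
  for \<open>j > k+1\<close> and \<open>m / (l r^{k-1-i}) a_{i,k+1}\<close> for
  \<open>i < k\<close>; after extracting \<open>m / r^{k+2}\<close> the weights are
  \<open>r^j\<close> and \<open>r^{i+3} / l\<close>. Transforming \<open>f_i\<close> as a whole
  keeps sums out of the braid relation. The exceptional values \<open>r\<close> and
  \<open>-r^3\<close> come from the factor of the one coordinate that enters the transformation of
  the \<open>f_i\<close>. The values with \<open>n\<close> in the exponent come from the upper end
  of geometric sums of \<open>r^{2j}\<close>. All subspaces are over F, so a scalar may be divided
  out only after it is shown to lie in F.\<close>

lemma ground_set_closed: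
  shows ground_one: "1 \<in> ground_set l r"
    and ground_zero: "0 \<in> ground_set l r"
    and ground_l: "l \<in> ground_set l r"
    and ground_r: "r \<in> ground_set l r"
    and ground_add: "\<And>a b. a \<in> ground_set l r \<Longrightarrow> b \<in> ground_set l r \<Longrightarrow> a + b \<in> ground_set l r"
    and ground_mult: "\<And>a b. a \<in> ground_set l r \<Longrightarrow> b \<in> ground_set l r \<Longrightarrow> a * b \<in> ground_set l r"
    and ground_uminus: "\<And>a. a \<in> ground_set l r \<Longrightarrow> - a \<in> ground_set l r"
    and ground_inverse: "\<And>a. a \<in> ground_set l r \<Longrightarrow> inverse a \<in> ground_set l r"
proof -
  let ?C = "ring_of_type_algebra :: complex ring"
  interpret C: field ?C by (rule field_from_type_algebra)
  have carr: "carrier ?C = UNIV" by (simp add: ring_of_type_algebra_def)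
  have sub: "subfield (ground_set l r) ?C"
    unfolding ground_set_def by (rule C.generate_field_is_subfield) (simp add: carr)
  show "1 \<in> ground_set l r"
    using generate_field.one[of ?C "{l, r}"] by (simp add: ground_set_def ring_of_type_algebra_def)
  show zero: "0 \<in> ground_set l r"
    using C.zero_in_generate[of "{l, r}"] by (simp add: ground_set_def ring_of_type_algebra_def)
  show "l \<in> ground_set l r" "r \<in> ground_set l r"
    unfolding ground_set_def by (auto intro: generate_field.incl)
  show "a + b \<in> ground_set l r" if "a \<in> ground_set l r" "b \<in> ground_set l r" for a b
    using generate_field.eng_add[OF that[unfolded ground_set_def]]
    by (simp add: ground_set_def ring_of_type_algebra_def)
  show "a * b \<in> ground_set l r" if "a \<in> ground_set l r" "b \<in> ground_set l r" for a b
    using generate_field.eng_mult[OF that[unfolded ground_set_def]]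
    by (simp add: ground_set_def ring_of_type_algebra_def)
  show "- a \<in> ground_set l r" if "a \<in> ground_set l r" for a
  proof -
    have "\<ominus>\<^bsub>?C\<^esub> a = - a"
      by (rule C.minus_equality) (simp_all add: ring_of_type_algebra_def)
    then show ?thesis
      using generate_field.a_inv[OF that[unfolded ground_set_def]] by (simp add: ground_set_def)
  qed
  show "inverse a \<in> ground_set l r" if a: "a \<in> ground_set l r" for a
  proof (cases "a = 0")
    case True then show ?thesis using zero by simp
  next
    case False
    have "inv\<^bsub>?C\<^esub> a = inverse a"
      by (rule C.comm_inv_char) (use False in \<open>simp_all add: ring_of_type_algebra_def\<close>)
    moreover have "a \<noteq> \<zero>\<^bsub>?C\<^esub>" using False by (simp add: ring_of_type_algebra_def)
    ultimately show ?thesis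
      using generate_field.m_inv[OF a[unfolded ground_set_def]] by (simp add: ground_set_def)
  qed
qed

lemma ground_diff: "a \<in> ground_set l r \<Longrightarrow> b \<in> ground_set l r \<Longrightarrow> a - b \<in> ground_set l r"
  using ground_add[of a l r "- b"] ground_uminus by simp

lemma ground_divide: "a \<in> ground_set l r \<Longrightarrow> b \<in> ground_set l r \<Longrightarrow> a / b \<in> ground_set l r"
  using ground_mult[of a l r "inverse b"] ground_inverse by (simp add: divide_inverse)

lemma ground_power: "a \<in> ground_set l r \<Longrightarrow> a ^ k \<in> ground_set l r"
  by (induction k) (auto intro: ground_one ground_mult)

lemma ground_sum: "(\<And>i. i \<in> A \<Longrightarrow> f i \<in> ground_set l r) \<Longrightarrow> sum f A \<in> ground_set l r"
  by (induction A rule: infinite_finite_induct) (auto intro: ground_zero ground_add)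

lemma ground_m: "bmw_m r \<in> ground_set l r"
  unfolding bmw_m_def by (intro ground_diff ground_divide ground_one ground_r)

lemmas ground_intros = ground_one ground_zero ground_l ground_r ground_m ground_add ground_diff
  ground_mult ground_divide ground_uminus ground_inverse ground_power ground_sum

section \<open>Finitely supported vectors and linearity of \<open>nu_k\<close>\<close>

lemma lookup_lk_scale [simp]:
  "Poly_Mapping.lookup (lk_scale c v) p = c * Poly_Mapping.lookup v p"
  by (simp add: lk_scale_def Poly_Mapping.map.rep_eq when_def)

lemma lk_scale_add_right: "lk_scale c (u + v) = lk_scale c u + lk_scale c v"
  and lk_scale_diff_right: "lk_scale c (u - v) = lk_scale c u - lk_scale c v"
  and lk_scale_add_left: "lk_scale (c + d) v = lk_scale c v + lk_scale d v"
  and lk_scale_scale: "lk_scale c (lk_scale d v) = lk_scale (c * d) v"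
  and lk_scale_zero_left: "lk_scale 0 v = 0"
  and lk_scale_zero_right: "lk_scale c 0 = 0"
  and lk_scale_one: "lk_scale 1 v = v"
  and lk_scale_minus_one: "lk_scale (- 1) v = - v"
  by (rule poly_mapping_eqI; simp add: lookup_add lookup_minus algebra_simps)+

lemma lk_scale_sum_right: "lk_scale c (\<Sum>i\<in>A. f i) = (\<Sum>i\<in>A. lk_scale c (f i))"
  by (rule poly_mapping_eqI) (simp add: lookup_sum sum_distrib_left)

lemma lk_expand:
  assumes "finite A" "Poly_Mapping.keys v \<subseteq> A"
  shows "v = (\<Sum>p\<in>A. lk_scale (Poly_Mapping.lookup v p) (lk_w (fst p) (snd p)))"
proof (rule poly_mapping_eqI)
  fix q
  have "(\<Sum>p\<in>A. Poly_Mapping.lookup v p * (1 when p = q)) = Poly_Mapping.lookup v q"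
    using assms by (auto simp: when_def in_keys_iff if_distrib cong: if_cong)
  then show "Poly_Mapping.lookup v q =
      Poly_Mapping.lookup (\<Sum>p\<in>A. lk_scale (Poly_Mapping.lookup v p) (lk_w (fst p) (snd p))) q"
    by (simp add: lookup_sum lk_w_def lookup_single)
qed

text \<open>\<open>nu\<close> sums over the support of its argument, and supports change under
  addition and scaling. Over a common finite index set the extra terms have coefficient 0 and
  linearity becomes termwise.\<close>

lemma nu_expand:
  assumes "finite A" "Poly_Mapping.keys v \<subseteq> A"
  shows "nu l r k v = (\<Sum>p\<in>A. lk_scale (Poly_Mapping.lookup v p) (nu_basis l r k (fst p) (snd p)))"
  unfolding nu_def case_prod_beta
  using assms by (intro sum.mono_neutral_cong_left) (auto simp: in_keys_iff lk_scale_zero_left)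

lemma nu_add: "nu l r k (u + v) = nu l r k u + nu l r k v"
proof -
  let ?A = "Poly_Mapping.keys u \<union> Poly_Mapping.keys v"
  have "Poly_Mapping.keys (u + v) \<subseteq> ?A" by (rule keys_add)
  then show ?thesis
    by (simp add: nu_expand[of ?A] lookup_add lk_scale_add_left sum.distrib)
qed

lemma nu_scale: "nu l r k (lk_scale c v) = lk_scale c (nu l r k v)"
proof -
  let ?A = "Poly_Mapping.keys v"
  have "Poly_Mapping.keys (lk_scale c v) \<subseteq> ?A" by (auto simp: in_keys_iff)
  then show ?thesis
    by (simp add: nu_expand[of ?A] lk_scale_sum_right lk_scale_scale)
qed

lemma nu_zero: "nu l r k 0 = 0" by (simp add: nu_def)

lemma nu_diff: "nu l r k (u - v) = nu l r k u - nu l r k v"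
  using nu_add[of l r k "u - v" v] by (simp add: algebra_simps)

lemma lookup_lk_w: "Poly_Mapping.lookup (lk_w i j) p = (if p = (i, j) then 1 else 0)"
  by (simp add: lk_w_def lookup_single when_def)

lemma nu_w: "nu l r k (lk_w i j) = nu_basis l r k i j"
  by (simp add: nu_def lk_w_def lk_scale_one)

definition lk_index :: "nat \<Rightarrow> (nat \<times> nat) set" where
  "lk_index n = {(i, j). 1 \<le> i \<and> i < j \<and> j \<le> n}"

definition lk_carrier :: "nat \<Rightarrow> complex \<Rightarrow> complex \<Rightarrow> lk_vec set" where
  "lk_carrier n l r = carrier (lk_space n l r)"

lemma lk_carrier_iff: "v \<in> lk_carrier n l r \<longleftrightarrow>
  (\<forall>p. Poly_Mapping.lookup v p \<in> ground_set l r) \<and> Poly_Mapping.keys v \<subseteq> lk_index n"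
  by (simp add: lk_carrier_def lk_space_def lk_index_def)

lemma finite_lk_index: "finite (lk_index n)"
  by (rule finite_subset[of _ "{..n} \<times> {..n}"]) (auto simp: lk_index_def)

lemma lk_carrier_zero: "0 \<in> lk_carrier n l r"
  by (simp add: lk_carrier_iff ground_zero)

lemma lk_carrier_add: "u \<in> lk_carrier n l r \<Longrightarrow> v \<in> lk_carrier n l r \<Longrightarrow> u + v \<in> lk_carrier n l r"
  unfolding lk_carrier_iff using keys_add[of u v] by (auto simp: lookup_add intro: ground_add)

lemma lk_carrier_scale: "c \<in> ground_set l r \<Longrightarrow> v \<in> lk_carrier n l r \<Longrightarrow> lk_scale c v \<in> lk_carrier n l r"
  unfolding lk_carrier_iff by (auto simp: in_keys_iff subset_iff intro: ground_mult)

lemma lk_carrier_diff: "u \<in> lk_carrier n l r \<Longrightarrow> v \<in> lk_carrier n l r \<Longrightarrow> u - v \<in> lk_carrier n l r"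
  using lk_carrier_add[of u n l r "lk_scale (- 1) v"] lk_carrier_scale[of "- 1" l r v n]
  by (simp add: lk_scale_minus_one ground_intros)

lemma lk_carrier_sum: "(\<And>i. i \<in> A \<Longrightarrow> f i \<in> lk_carrier n l r) \<Longrightarrow> sum f A \<in> lk_carrier n l r"
  by (induction A rule: infinite_finite_induct) (auto intro: lk_carrier_zero lk_carrier_add)

lemma lk_carrier_w: "1 \<le> i \<Longrightarrow> i < j \<Longrightarrow> j \<le> n \<Longrightarrow> lk_w i j \<in> lk_carrier n l r"
  unfolding lk_carrier_iff
  by (auto simp: lk_w_def lookup_single when_def lk_index_def ground_intros)

lemma lk_carrier_nu:
  assumes "v \<in> lk_carrier n l r" "1 \<le> k" "k < n"
  shows "nu l r k v \<in> lk_carrier n l r"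
proof -
  have "nu_basis l r k i j \<in> lk_carrier n l r" if "(i, j) \<in> lk_index n" for i j
    using that assms(2,3) unfolding nu_basis_def lk_index_def
    by (auto intro!: lk_carrier_add lk_carrier_diff lk_carrier_scale lk_carrier_w ground_intros)
  moreover have "Poly_Mapping.keys v \<subseteq> lk_index n" "\<And>p. Poly_Mapping.lookup v p \<in> ground_set l r"
    using assms(1) by (auto simp: lk_carrier_iff)
  ultimately show ?thesis
    unfolding nu_expand[OF finite_lk_index \<open>_ \<subseteq> _\<close>]
    by (auto intro!: lk_carrier_sum lk_carrier_scale)
qed

text \<open>The formulas for the coordinates of \<open>nu_k v\<close> and for
  \<open>f_i (nu_k v)\<close> are verified on basis vectors through this lemma. Linearity is asked
  over all complex scalars and all finitely supported functions, so no membership in F has to be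
  tracked.\<close>

lemma linear_functional_ext:
  fixes \<phi> \<psi> :: "lk_vec \<Rightarrow> complex"
  assumes "\<And>u v. \<phi> (u + v) = \<phi> u + \<phi> v" "\<And>c v. \<phi> (lk_scale c v) = c * \<phi> v"
    and "\<And>u v. \<psi> (u + v) = \<psi> u + \<psi> v" "\<And>c v. \<psi> (lk_scale c v) = c * \<psi> v"
    and basis: "\<And>a b. 1 \<le> a \<Longrightarrow> a < b \<Longrightarrow> b \<le> n \<Longrightarrow> \<phi> (lk_w a b) = \<psi> (lk_w a b)"
    and v: "Poly_Mapping.keys v \<subseteq> lk_index n"
  shows "\<phi> v = \<psi> v"
proof -
  have zero: "\<phi> 0 = 0" "\<psi> 0 = 0"
    using assms(2)[of 0 0] assms(4)[of 0 0] by (simp_all add: lk_scale_zero_left)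
  have sum: "\<theta> (\<Sum>p\<in>A. f p) = (\<Sum>p\<in>A. \<theta> (f p))"
    if "\<theta> 0 = 0" "\<And>u v. \<theta> (u + v) = \<theta> u + \<theta> v"
    for A and f :: "nat \<times> nat \<Rightarrow> lk_vec" and \<theta> :: "lk_vec \<Rightarrow> complex"
    using sum_comp_morphism[of \<theta> f A] that by (simp add: o_def)
  let ?v = "\<Sum>p\<in>lk_index n. lk_scale (Poly_Mapping.lookup v p) (lk_w (fst p) (snd p))"
  have e: "v = ?v" by (rule lk_expand[OF finite_lk_index v])
  have "\<phi> v = \<phi> ?v" by (rule arg_cong[OF e])
  also have "\<dots> = \<psi> ?v"
    unfolding sum[OF zero(1) assms(1)] sum[OF zero(2) assms(3)] assms(2,4)
    by (rule sum.cong) (auto simp: lk_index_def basis)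
  also have "\<dots> = \<psi> v" by (rule arg_cong[OF e[symmetric]])
  finally show ?thesis .
qed

text \<open>These are the branches of \<open>nu_basis\<close>. The offset \<open>d\<close> replaces
  the truncated subtractions \<open>j - k - 2\<close> and \<open>k - 1 - i\<close> in its
  exponents.\<close>

lemma pair_position:
  fixes a b k :: nat
  assumes "a < b"
  obtains "{a, b} \<inter> {k, k + 1} = {}" | "a = k" "b = k + 1" | "a = k" "b > k + 1"
    | d where "a = k + 1" "b = k + 2 + d" | "a < k" "b = k" | d where "k = a + 1 + d" "b = k + 1"
proof -
  have "\<exists>d. b = k + 2 + d" if "a = k + 1" using that assms by (intro le_Suc_ex) simp
  moreover have "\<exists>d. k = a + 1 + d" if "b = k + 1" "a \<noteq> k" using that assms by (intro le_Suc_ex) simp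
  ultimately show thesis using that assms
    by (cases "a = k"; cases "a = k + 1"; cases "b = k"; cases "b = k + 1") auto
qed

section \<open>Convolution products as sums of monomials\<close>

lemma poly_mapping_expand:
  fixes p :: "'a \<Rightarrow>\<^sub>0 'b::comm_monoid_add"
  shows "p = (\<Sum>w\<in>Poly_Mapping.keys p. Poly_Mapping.single w (Poly_Mapping.lookup p w))"
proof (rule poly_mapping_eqI)
  fix q
  have "(\<Sum>w\<in>Poly_Mapping.keys p. Poly_Mapping.lookup p w when w = q) = Poly_Mapping.lookup p q"
    by (auto simp: when_def in_keys_iff)
  then show "Poly_Mapping.lookup p q =
      Poly_Mapping.lookup (\<Sum>w\<in>Poly_Mapping.keys p. Poly_Mapping.single w (Poly_Mapping.lookup p w)) q"
    by (simp add: lookup_sum lookup_single)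
qed

lemma mult_expand:
  fixes p q :: "'a::monoid_add \<Rightarrow>\<^sub>0 'b::semiring_0"
  shows "p * q = (\<Sum>u\<in>Poly_Mapping.keys p. \<Sum>w\<in>Poly_Mapping.keys q.
    Poly_Mapping.single (u + w) (Poly_Mapping.lookup p u * Poly_Mapping.lookup q w))"
  by (subst poly_mapping_expand[of p], subst poly_mapping_expand[of q])
     (simp only: sum_product mult_single)

lemma ring_ring_of_type_algebra: "ring (ring_of_type_algebra :: 'a::ring_1 ring)"
proof -
  have "\<exists>y. x + y = 0" for x :: 'a using add.right_inverse by blast
  then show ?thesis
    unfolding ring_of_type_algebra_def by unfold_locales (auto simp: algebra_simps Units_def)
qed

section \<open>The functionals \<open>f_i\<close> and the coordinate form of
  \<open>nu_k\<close>\<close>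

locale lk_params =
  fixes n :: nat and l r :: complex
  assumes l: "l \<noteq> 0" and r: "r \<noteq> 0" and r2: "r\<^sup>2 \<noteq> 1"
begin

abbreviation "m \<equiv> bmw_m r"

lemma m_r: "m * r = 1 - r\<^sup>2" using r by (simp add: bmw_m_def field_simps power2_eq_square)
lemma m_nz: "m \<noteq> 0" using m_r r2 by auto

definition fsum :: "nat \<Rightarrow> lk_vec \<Rightarrow> complex" where
  "fsum i v = (\<Sum>j\<in>{i<..n}. r ^ j * Poly_Mapping.lookup v (i, j))
     + r ^ 3 / l * (\<Sum>j\<in>{1..<i}. r ^ j * Poly_Mapping.lookup v (j, i))"

lemma fsum_add: "fsum i (u + v) = fsum i u + fsum i v"
  by (simp add: fsum_def lookup_add algebra_simps sum.distrib)

lemma fsum_scale: "fsum i (lk_scale c v) = c * fsum i v"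
  by (simp add: fsum_def sum_distrib_left algebra_simps)

lemma fsum_diff: "fsum i (u - v) = fsum i u - fsum i v"
  using fsum_add[of i "u - v" v] by (simp add: algebra_simps)

lemma fsum_w:
  assumes "1 \<le> a" "a < b" "b \<le> n"
  shows "fsum i (lk_w a b) = (if i = a then r ^ b else if i = b then r ^ 3 / l * r ^ a else 0)"
proof -
  have "(\<Sum>j\<in>{i<..n}. r ^ j * Poly_Mapping.lookup (lk_w a b) (i, j)) =
      (\<Sum>j\<in>{i<..n}. if j = b then if i = a then r ^ b else 0 else 0)"
    by (rule sum.cong) (auto simp: lookup_lk_w)
  moreover have "(\<Sum>j\<in>{1..<i}. r ^ j * Poly_Mapping.lookup (lk_w a b) (j, i)) =
      (\<Sum>j\<in>{1..<i}. if j = a then if i = b then r ^ a else 0 else 0)"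
    by (rule sum.cong) (auto simp: lookup_lk_w)
  ultimately show ?thesis using assms by (simp add: fsum_def sum.delta)
qed

lemmas fsum_linear = fsum_add fsum_scale fsum_diff

text \<open>The transpose of \<open>nu_basis\<close>: it reads the coordinates of
  \<open>nu_k v\<close> off those of \<open>v\<close>. At \<open>(k, k+1)\<close> the coefficient is
  \<open>r^2 / l\<close> and not \<open>1 / l\<close>, because \<open>f_{k+1}\<close> already
  contains \<open>a_{k,k+1}\<close> and contributes \<open>m r / l\<close>; the two add up to
  \<open>1 / l\<close> since \<open>r^2 + m r = 1\<close>.\<close>

definition nu_coord :: "nat \<Rightarrow> lk_vec \<Rightarrow> nat \<Rightarrow> nat \<Rightarrow> complex" where
  "nu_coord k v i j =
     (let a = (\<lambda>i j. Poly_Mapping.lookup v (i, j)) in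
      if {i, j} \<inter> {k, k + 1} = {} then r * a i j
      else if i = k \<and> j = k + 1 then r\<^sup>2 / l * a k (k + 1) + m / r ^ (k + 2) * fsum (k + 1) v
      else if i = k then a (k + 1) j
      else if i = k + 1 then a k j - m * a (k + 1) j
      else if j = k then a i (k + 1)
      else a i k - m * a i (k + 1))"

lemma nu_basis_disjoint:
  "{a, b} \<inter> {k, k + 1} = {} \<Longrightarrow> nu_basis l r k a b = lk_scale r (lk_w a b)"
  by (simp add: nu_basis_def)

lemma nu_basis_simps:
  shows "nu_basis l r k k (Suc k) = lk_scale (inverse l) (lk_w k (Suc k))"
    and "b > Suc k \<Longrightarrow> nu_basis l r k k b = lk_w (Suc k) b"
    and "nu_basis l r k (Suc k) (Suc (Suc (k + d))) =
      lk_w k (Suc (Suc (k + d))) + lk_scale (m * r ^ d) (lk_w k (Suc k))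
        - lk_scale m (lk_w (Suc k) (Suc (Suc (k + d))))"
    and "a < k \<Longrightarrow> nu_basis l r k a k = lk_w a (Suc k)"
    and "nu_basis l r (Suc (a + d)) a (Suc (Suc (a + d))) = lk_w a (Suc (a + d))
      + lk_scale (m / (l * r ^ d)) (lk_w (Suc (a + d)) (Suc (Suc (a + d))))
      - lk_scale m (lk_w a (Suc (Suc (a + d))))"
  by (auto simp: nu_basis_def)

lemma nu_coord_add: "nu_coord k (u + v) i j = nu_coord k u i j + nu_coord k v i j"
  by (simp add: nu_coord_def Let_def fsum_add lookup_add distrib_left)

lemma nu_coord_scale: "nu_coord k (lk_scale c v) i j = c * nu_coord k v i j"
  by (simp add: nu_coord_def Let_def fsum_scale algebra_simps)

lemma nu_coord_basis:
  assumes "1 \<le> k" "k < n" "1 \<le> a" "a < b" "b \<le> n" "1 \<le> i" "i < j" "j \<le> n"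
  shows "Poly_Mapping.lookup (nu_basis l r k a b) (i, j) = nu_coord k (lk_w a b) i j"
proof (cases "i = k \<and> j = k + 1")
  case False
  note defs = nu_coord_def Let_def lookup_add lookup_minus lookup_lk_w nu_basis_simps nu_basis_disjoint
  from assms(4) show ?thesis
    using False assms(6-) by (cases rule: pair_position[where k = k]) (auto simp: defs)
next
  case True
  note defs = lookup_add lookup_minus lookup_lk_w nu_basis_simps nu_basis_disjoint
  have "Poly_Mapping.lookup (nu_basis l r k a b) (k, k + 1) =
      r\<^sup>2 / l * Poly_Mapping.lookup (lk_w a b) (k, k + 1) + m / r ^ (k + 2) * fsum (k + 1) (lk_w a b)"
    using assms(4)
  proof (cases rule: pair_position[where k = k])
    case 1
    with assms show ?thesis by (auto simp: defs fsum_w)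
  next
    case 2
    have "inverse l = r\<^sup>2 / l + m * (r ^ 3 * r ^ k) / (l * (r * (r * r ^ k)))"
      using r l by (simp add: bmw_m_def field_simps power2_eq_square power3_eq_cube)
    with 2 assms show ?thesis by (simp add: defs fsum_w mult_ac)
  next
    case 3
    with assms show ?thesis by (auto simp: defs fsum_w)
  next
    case (4 d)
    with assms r show ?thesis by (simp add: defs fsum_w power_add)
  next
    case 5
    with assms show ?thesis by (auto simp: defs fsum_w)
  next
    case (6 d)
    with assms r l show ?thesis by (simp add: defs fsum_w power_add power3_eq_cube)
  qed
  with True show ?thesis by (simp add: nu_coord_def)
qed

lemma lookup_nu:
  assumes "1 \<le> k" "k < n" "v \<in> lk_carrier n l r" "1 \<le> i" "i < j" "j \<le> n"
  shows "Poly_Mapping.lookup (nu l r k v) (i, j) = nu_coord k v i j"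
proof (rule linear_functional_ext[where \<phi> = "\<lambda>v. Poly_Mapping.lookup (nu l r k v) (i, j)"
      and \<psi> = "\<lambda>v. nu_coord k v i j" and n = n])
  show "Poly_Mapping.keys v \<subseteq> lk_index n" using assms(3) by (simp add: lk_carrier_iff)
  show "Poly_Mapping.lookup (nu l r k (lk_w a b)) (i, j) = nu_coord k (lk_w a b) i j"
    if "1 \<le> a" "a < b" "b \<le> n" for a b
    using nu_coord_basis[OF assms(1,2) that assms(4-6)] by (simp add: nu_w)
qed (simp_all add: nu_add nu_scale lookup_add nu_coord_add nu_coord_scale)

text \<open>Only the last summand at \<open>i = k + 1\<close> involves a coordinate. Its factor
  \<open>r^4 / l^2 + m r^2 / l - 1\<close> equals \<open>-(l - r)(l + r^3) / l^2\<close>, so for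
  \<open>l = r\<close> and \<open>l = -r^3\<close> each \<open>nu_k\<close> maps the values of the
  \<open>f_i\<close> to combinations of those same values, and their common kernel is
  stable.\<close>

definition nu_fsum :: "nat \<Rightarrow> lk_vec \<Rightarrow> nat \<Rightarrow> complex" where
  "nu_fsum k v i =
     (if i = k then fsum (k + 1) v / r\<^sup>2
      else if i = k + 1 then fsum k v + (m * r / l - m) * fsum (k + 1) v
        + Poly_Mapping.lookup v (k, k + 1) * r ^ (k + 1) * (r ^ 4 / l\<^sup>2 + m * r\<^sup>2 / l - 1)
      else r * fsum i v)"

lemma nu_fsum_add: "nu_fsum k (u + v) i = nu_fsum k u i + nu_fsum k v i"
  by (simp add: nu_fsum_def fsum_add lookup_add distrib_left distrib_right add_divide_distrib)

lemma nu_fsum_scale: "nu_fsum k (lk_scale c v) i = c * nu_fsum k v i"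
  by (simp add: nu_fsum_def fsum_scale distrib_left mult_ac)

lemma fsum_nu_basis:
  assumes "1 \<le> k" "k < n" "1 \<le> a" "a < b" "b \<le> n" "1 \<le> i" "i \<le> n"
  shows "fsum i (nu_basis l r k a b) = nu_fsum k (lk_w a b) i"
proof -
  note defs = nu_fsum_def fsum_w fsum_linear lookup_lk_w nu_basis_simps nu_basis_disjoint
  from assms(4) show ?thesis
  proof (cases rule: pair_position[where k = k])
    case 1
    with assms show ?thesis by (auto simp: defs)
  next
    case 2
    have "inverse l * (r ^ 3 / l * r ^ k) = r * r ^ k + (m * r / l - m) * (r ^ 3 / l * r ^ k)
        + r * r ^ k * (r ^ 4 / l\<^sup>2 + m * r\<^sup>2 / l - 1)"
      using r l by (simp add: bmw_m_def field_simps eval_nat_numeral)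
    moreover have "inverse l * (r * r ^ k) = r ^ 3 / l * r ^ k / r\<^sup>2"
      using r by (simp add: field_simps eval_nat_numeral)
    ultimately show ?thesis using 2 assms by (auto simp: defs mult_ac)
  next
    case 3
    with assms r show ?thesis by (auto simp: defs power2_eq_square)
  next
    case (4 d)
    have "r ^ b + m * r ^ d * r ^ (k + 1) = r ^ b / r\<^sup>2"
      using r 4 by (simp add: bmw_m_def power_add divide_simps) (simp add: algebra_simps power2_eq_square)
    moreover have "r ^ 3 / l * r ^ k - m * (r ^ 3 / l * r ^ (k + 1)) = r * (r ^ 3 / l * r ^ (k + 1))"
      using r l by (simp add: bmw_m_def divide_simps) (simp add: algebra_simps power2_eq_square)
    moreover have "m * r ^ d * (r ^ 3 / l * r ^ k) - m * r ^ b = (m * r / l - m) * r ^ b"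
      using 4 by (simp add: power_add power2_eq_square power3_eq_cube algebra_simps)
    ultimately show ?thesis using 4 assms by (auto simp: defs mult_ac)
  next
    case 5
    with assms show ?thesis by (auto simp: defs)
  next
    case (6 d)
    have "r ^ k - m * r ^ (k + 1) = r * r ^ (k + 1)"
      using r l by (simp add: bmw_m_def divide_simps) (simp add: algebra_simps power2_eq_square)
    moreover have "r ^ 3 / l * r ^ a + m / (l * r ^ d) * r ^ (k + 1) = r ^ 3 / l * r ^ a / r\<^sup>2"
      using r l 6 by (simp add: bmw_m_def power_add divide_simps)
         (simp add: algebra_simps power2_eq_square power3_eq_cube)
    moreover have "m / (l * r ^ d) * (r ^ 3 / l * r ^ k) = m * r / l * (r ^ 3 / l * r ^ a)"
      using r l 6 by (simp add: power_add)
    then have "m / (l * r ^ d) * (r ^ 3 / l * r ^ k) - m * (r ^ 3 / l * r ^ a) =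
        (m * r / l - m) * (r ^ 3 / l * r ^ a)"
      by (simp only: left_diff_distrib)
    ultimately show ?thesis using 6 assms by (auto simp: defs mult_ac)
  qed
qed

lemma fsum_nu:
  assumes "1 \<le> k" "k < n" "v \<in> lk_carrier n l r" "1 \<le> i" "i \<le> n"
  shows "fsum i (nu l r k v) = nu_fsum k v i"
proof (rule linear_functional_ext[where \<phi> = "\<lambda>v. fsum i (nu l r k v)"
      and \<psi> = "\<lambda>v. nu_fsum k v i" and n = n])
  show "Poly_Mapping.keys v \<subseteq> lk_index n" using assms(3) by (simp add: lk_carrier_iff)
  show "fsum i (nu l r k (lk_w a b)) = nu_fsum k (lk_w a b) i"
    if "1 \<le> a" "a < b" "b \<le> n" for a b
    using fsum_nu_basis[OF assms(1,2) that assms(4,5)] by (simp add: nu_w)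
qed (simp_all add: nu_add nu_scale fsum_linear nu_fsum_add nu_fsum_scale)

section \<open>Compatibility with the braid relations\<close>

lemma lk_carrier_eqI:
  assumes "u \<in> lk_carrier n l r" "v \<in> lk_carrier n l r"
    and "\<And>i j. 1 \<le> i \<Longrightarrow> i < j \<Longrightarrow> j \<le> n \<Longrightarrow>
      Poly_Mapping.lookup u (i, j) = Poly_Mapping.lookup v (i, j)"
  shows "u = v"
proof (rule poly_mapping_eqI)
  fix p
  show "Poly_Mapping.lookup u p = Poly_Mapping.lookup v p"
  proof (cases "p \<in> lk_index n")
    case True then show ?thesis using assms(3) by (auto simp: lk_index_def)
  next
    case False
    then have "p \<notin> Poly_Mapping.keys u" "p \<notin> Poly_Mapping.keys v"
      using assms(1,2) by (auto simp: lk_carrier_iff)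
    then show ?thesis by (simp add: in_keys_iff)
  qed
qed

text \<open>A pair disjoint from \<open>{k, k+1}\<close> is split into three cases by its position,
  so that every case supplies the positive order facts that serve as side conditions of
  \<open>lookup_nu_simps\<close>.\<close>

lemma pair_order_cases:
  fixes i j k :: nat
  assumes "i < j"
  obtains "j < k" | "i < k" "j > Suc k" | "i > Suc k" | "i = k" "j = Suc k" | "i = k" "j > Suc k"
    | "i = Suc k" "j > Suc k" | "i < k" "j = k" | "i < k" "j = Suc k"
  using assms by (metis Suc_lessI linorder_neqE_nat not_less_eq)

lemma lookup_nu_simps:
  assumes "1 \<le> k" "k < n" "v \<in> lk_carrier n l r"
  shows "\<lbrakk>1 \<le> i; i < j; j < k\<rbrakk> \<Longrightarrow>
      Poly_Mapping.lookup (nu l r k v) (i, j) = r * Poly_Mapping.lookup v (i, j)"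
    and "\<lbrakk>1 \<le> i; i < k; Suc k < j; j \<le> n\<rbrakk> \<Longrightarrow>
      Poly_Mapping.lookup (nu l r k v) (i, j) = r * Poly_Mapping.lookup v (i, j)"
    and "\<lbrakk>Suc k < i; i < j; j \<le> n\<rbrakk> \<Longrightarrow>
      Poly_Mapping.lookup (nu l r k v) (i, j) = r * Poly_Mapping.lookup v (i, j)"
    and "Poly_Mapping.lookup (nu l r k v) (k, Suc k) =
      r\<^sup>2 / l * Poly_Mapping.lookup v (k, Suc k) + m / r ^ (k + 2) * fsum (Suc k) v"
    and "\<lbrakk>Suc k < j; j \<le> n\<rbrakk> \<Longrightarrow>
      Poly_Mapping.lookup (nu l r k v) (k, j) = Poly_Mapping.lookup v (Suc k, j)"
    and "\<lbrakk>Suc k < j; j \<le> n\<rbrakk> \<Longrightarrow> Poly_Mapping.lookup (nu l r k v) (Suc k, j) =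
      Poly_Mapping.lookup v (k, j) - m * Poly_Mapping.lookup v (Suc k, j)"
    and "\<lbrakk>1 \<le> i; i < k\<rbrakk> \<Longrightarrow>
      Poly_Mapping.lookup (nu l r k v) (i, k) = Poly_Mapping.lookup v (i, Suc k)"
    and "\<lbrakk>1 \<le> i; i < k\<rbrakk> \<Longrightarrow> Poly_Mapping.lookup (nu l r k v) (i, Suc k) =
      Poly_Mapping.lookup v (i, k) - m * Poly_Mapping.lookup v (i, Suc k)"
  using assms by (auto simp: lookup_nu nu_coord_def Let_def)

lemma fsum_nu_simps:
  assumes "1 \<le> k" "k < n" "v \<in> lk_carrier n l r"
  shows "\<lbrakk>1 \<le> i; i < k\<rbrakk> \<Longrightarrow> fsum i (nu l r k v) = r * fsum i v"
    and "\<lbrakk>Suc k < i; i \<le> n\<rbrakk> \<Longrightarrow> fsum i (nu l r k v) = r * fsum i v"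
    and "fsum k (nu l r k v) = fsum (Suc k) v / r\<^sup>2"
    and "fsum (Suc k) (nu l r k v) = fsum k v + (m * r / l - m) * fsum (Suc k) v
        + Poly_Mapping.lookup v (k, Suc k) * r ^ (k + 1) * (r ^ 4 / l\<^sup>2 + m * r\<^sup>2 / l - 1)"
  using assms by (auto simp: fsum_nu nu_fsum_def)

lemmas nu_simps = lookup_nu_simps fsum_nu_simps lk_carrier_nu

text \<open>Here and below, order facts are given to the simplifier as rewrite rules: as premises they would
  all enter linear arithmetic at every failed side condition, which is prohibitively slow.\<close>

lemma nu_commute:
  assumes "1 \<le> k" "k + 2 \<le> k'" "k' < n" and v: "v \<in> lk_carrier n l r"
  shows "nu l r k (nu l r k' v) = nu l r k' (nu l r k v)"
proof (rule lk_carrier_eqI)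
  fix i j assume ij: "1 \<le> i" "i < j" "j \<le> n"
  have k: "k < n" "1 \<le> k'" "Suc k < k'" "Suc k < Suc k'" "k < k'" "k < Suc k'" "k' \<le> n" "Suc k' \<le> n"
    "k \<le> n" "Suc k \<le> n"
    "i < k \<Longrightarrow> i < Suc k" "i < k \<Longrightarrow> i < k'" "i < k' \<Longrightarrow> i < Suc k'" "1 \<le> Suc k" "1 \<le> Suc k'" "Suc k < i \<Longrightarrow> k < i"
    "Suc k < j \<Longrightarrow> k < j" "Suc k' < j \<Longrightarrow> k' < j" "Suc k' < j \<Longrightarrow> k < j" "Suc k' < j \<Longrightarrow> Suc k < j"
    using assms(1-3) by linarith+
  show "Poly_Mapping.lookup (nu l r k (nu l r k' v)) (i, j) = Poly_Mapping.lookup (nu l r k' (nu l r k v)) (i, j)"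
    using ij(2)
  proof (cases rule: pair_order_cases[where k = k])
    case A: 1
    then have "j < k'" "i < k'" using ij k by linarith+
    then show ?thesis by (simp only: A nu_simps ij k assms(1,3) v lessI; simp add: algebra_simps)
  next
    case A: 2
    then have "i < k'" using k by linarith
    consider "j < k'" | "j = k'" | "j = Suc k'" | "Suc k' < j" by linarith
    then show ?thesis using \<open>i < k'\<close> by cases (simp only: A nu_simps ij k assms(1,3) v lessI; simp add: algebra_simps)+
  next
    case A: 3
    from ij(2) show ?thesis
      by (cases rule: pair_order_cases[where k = k']) (simp only: A nu_simps ij k assms(1,3) v lessI; simp add: algebra_simps)+
  next
    case A: 4
    then have "j < k'" "i < k'" using ij k by linarith+
    then show ?thesis by (simp only: A nu_simps ij k assms(1,3) v lessI; simp add: algebra_simps)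
  next
    case A: 5
    then have "i < k'" using k by linarith
    consider "j < k'" | "j = k'" | "j = Suc k'" | "Suc k' < j" by linarith
    then show ?thesis using \<open>i < k'\<close> by cases (simp only: A nu_simps ij k assms(1,3) v lessI; simp add: algebra_simps)+
  next
    case A: 6
    then have "i < k'" using k by linarith
    consider "j < k'" | "j = k'" | "j = Suc k'" | "Suc k' < j" by linarith
    then show ?thesis using \<open>i < k'\<close> by cases (simp only: A nu_simps ij k assms(1,3) v lessI; simp add: algebra_simps)+
  next
    case A: 7
    then have "j < k'" "i < k'" using ij k by linarith+
    then show ?thesis by (simp only: A nu_simps ij k assms(1,3) v lessI; simp add: algebra_simps)
  next
    case A: 8
    then have "j < k'" "i < k'" using ij k by linarith+
    then show ?thesis by (simp only: A nu_simps ij k assms(1,3) v lessI; simp add: algebra_simps)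
  qed
qed (use assms in \<open>auto intro!: lk_carrier_nu\<close>)

text \<open>The two sides of the braid relation involve functionals only at the entries
  \<open>(k, k+1)\<close>, \<open>(k, k+2)\<close> and \<open>(k+1, k+2)\<close>; this identity and
  the next two settle them in this order. There \<open>A\<close>, \<open>B\<close>, \<open>C\<close>
  stand for \<open>a_{k,k+1}\<close>, \<open>a_{k,k+2}\<close>, \<open>a_{k+1,k+2}\<close>, while
  \<open>F\<close> and \<open>G\<close> stand for \<open>f_{k+1}\<close> and \<open>f_{k+2}\<close>.
  Here \<open>a\<close> is the common term \<open>r^2 / l * C\<close>.\<close>

lemma braid_identity_12:
  "a + m / r ^ (k + 2) * (r * G / r\<^sup>2) = a + m / r ^ (Suc k + 2) * G"
  using r by (simp add: power2_eq_square)

lemma braid_identity_13: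
  "r\<^sup>2 / l * (B - m * C) + m / r ^ (Suc k + 2) * (r * G) =
    r\<^sup>2 / l * B + m / r ^ (k + 2) * (G / r\<^sup>2) - m * (r\<^sup>2 / l * C + m / r ^ (Suc k + 2) * G)"
proof -
  define q where "q = m / r ^ (Suc k + 2)"
  have "m / r ^ (k + 2) * (G / r\<^sup>2) = q / r * G"
    using r by (simp add: q_def power2_eq_square)
  moreover have "q * (r * G) = q / r * G - m * (q * G)"
    using r by (simp add: bmw_m_def algebra_simps)
  ultimately show ?thesis
    unfolding q_def[symmetric] by (simp add: algebra_simps diff_divide_distrib)
qed

lemma braid_identity_23:
  "r\<^sup>2 / l * A + m / r ^ (k + 2) * F - m * C - m * (r\<^sup>2 / l * (B - m * C) + m / r ^ (Suc k + 2) * (r * G)) =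
   r\<^sup>2 / l * (A - m * B - m * (r\<^sup>2 / l * C + m / r ^ (Suc k + 2) * G))
    + m / r ^ (Suc k + 2) * (r * (F + (m * r / l - m) * G + C * r ^ (Suc k + 1) * (r ^ 4 / l\<^sup>2 + m * r\<^sup>2 / l - 1)))"
proof -
  define q y where "q = m / r ^ (Suc k + 2)" and "y = 1 / l"
  have q1: "m / r ^ (k + 2) = q * r" and q2: "q * r ^ (Suc k + 1) * r = m"
    using r by (simp_all add: q_def)
  have *: "r\<^sup>2 / l = r\<^sup>2 * y" "m * r / l = m * r * y" "r ^ 4 / l\<^sup>2 = r ^ 4 * y\<^sup>2" "m * r\<^sup>2 / l = m * r\<^sup>2 * y"
    by (simp_all add: y_def power_divide)
  \<comment> \<open>The quadratic factor is kept as an opaque \<open>Q\<close>, so that the power of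
    \<open>r\<close> in front of \<open>C\<close> can be absorbed into \<open>q\<close> before
    anything is expanded.\<close>
  have e: "q * (r * (F + (m * r * y - m) * G + C * r ^ (Suc k + 1) * Q))
     = q * r * F + q * r * (m * r * y - m) * G + (q * r ^ (Suc k + 1) * r) * C * Q" for Q
    by (simp only: distrib_left mult_ac)
  show ?thesis
    unfolding * q_def[symmetric] q1 e q2 by (simp add: algebra_simps power2_eq_square eval_nat_numeral)
qed

lemma nu_braid:
  assumes "1 \<le> k" "Suc k < n" and v: "v \<in> lk_carrier n l r"
  shows "nu l r k (nu l r (Suc k) (nu l r k v)) = nu l r (Suc k) (nu l r k (nu l r (Suc k) v))"
proof (rule lk_carrier_eqI)
  fix i j assume ij: "1 \<le> i" "i < j" "j \<le> n"
  have k: "k < n" "1 \<le> Suc k" "k \<le> n" "Suc k \<le> n" "Suc (Suc k) \<le> n" "1 \<le> Suc (Suc k)" "k < Suc (Suc k)"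
    "i < k \<Longrightarrow> i < Suc k" "Suc (Suc k) < i \<Longrightarrow> Suc k < i"
    "Suc (Suc k) < j \<Longrightarrow> Suc k < j" "Suc (Suc k) < j \<Longrightarrow> k < j"
    using assms(1,2) by linarith+
  show "Poly_Mapping.lookup (nu l r k (nu l r (Suc k) (nu l r k v))) (i, j) =
      Poly_Mapping.lookup (nu l r (Suc k) (nu l r k (nu l r (Suc k) v))) (i, j)"
    using ij(2)
  proof (cases rule: pair_order_cases[where k = k])
    case A: 1
    then have "j < Suc k" by linarith
    then show ?thesis by (simp only: A nu_simps ij k assms v lessI)
  next
    case A: 2
    consider "j = Suc (Suc k)" | "Suc (Suc k) < j" using A by linarith
    then show ?thesis by cases (simp only: A nu_simps ij k assms v lessI; simp add: r l bmw_m_def field_simps eval_nat_numeral)+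
  next
    case A: 3
    consider "i = Suc (Suc k)" | "Suc (Suc k) < i" using A by linarith
    then show ?thesis by cases (use ij(2) in \<open>simp only: A nu_simps ij k assms v lessI; simp add: r l bmw_m_def field_simps eval_nat_numeral\<close>)+
  next
    case A: 4
    show ?thesis by (simp only: A nu_simps ij k assms v lessI braid_identity_12)
  next
    case A: 5
    consider "j = Suc (Suc k)" | "Suc (Suc k) < j" using A by linarith
    then show ?thesis
    proof cases
      case J: 1
      show ?thesis by (simp only: A J nu_simps ij k assms v lessI braid_identity_13)
    next
      case J: 2
      show ?thesis by (simp only: A J nu_simps ij k assms v lessI; simp add: r l bmw_m_def field_simps eval_nat_numeral)
    qed
  next
    case A: 6
    consider "j = Suc (Suc k)" | "Suc (Suc k) < j" using A by linarith
    then show ?thesis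
    proof cases
      case J: 1
      show ?thesis by (simp only: A J nu_simps ij k assms v lessI braid_identity_23)
    next
      case J: 2
      show ?thesis by (simp only: A J nu_simps ij k assms v lessI; simp add: r l bmw_m_def field_simps eval_nat_numeral)
    qed
  next
    case A: 7
    then show ?thesis by (simp only: A nu_simps ij k assms v lessI; simp add: r l bmw_m_def field_simps eval_nat_numeral)
  next
    case A: 8
    then show ?thesis by (simp only: A nu_simps ij k assms v lessI; simp add: r l bmw_m_def field_simps eval_nat_numeral)
  qed
qed (use assms in \<open>auto intro!: lk_carrier_nu\<close>)

section \<open>The quadratic relation\<close>

text \<open>Normalised so that $e_k v = l\, \varepsilon_k(v)\, w_{k,k+1}$. The first summand alone is
  $\varepsilon_k$ exactly when $l \in \{r, -r^3\}$.\<close>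

definition eps :: "nat \<Rightarrow> lk_vec \<Rightarrow> complex" where
  "eps k v = (fsum k v + fsum (Suc k) v / l) / r ^ (k + 2)
     + Poly_Mapping.lookup v (k, Suc k) * ((1 / l\<^sup>2 + m / l - 1) / m - 1 / r - r / l\<^sup>2)"

lemma eps_add: "eps k (u + v) = eps k u + eps k v"
  by (simp add: eps_def fsum_add lookup_add add_divide_distrib distrib_right)

lemma eps_scale: "eps k (lk_scale c v) = c * eps k v"
  by (simp add: eps_def fsum_scale distrib_left mult.assoc)

lemma eps_diff: "eps k (u - v) = eps k u - eps k v"
  using eps_add[of k "u - v" v] by (simp add: algebra_simps)

lemma eps_zero: "eps k 0 = 0"
  using eps_scale[of k 0 0] by (simp add: lk_scale_zero_left)

lemma eps_sum: "eps k (\<Sum>i\<in>A. f i) = (\<Sum>i\<in>A. eps k (f i))"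
  using sum_comp_morphism[of "eps k" f A] by (simp add: o_def eps_zero eps_add)

lemmas eps_linear = eps_add eps_scale eps_diff eps_zero eps_sum

text \<open>This is the entry \<open>(k, k+1)\<close> of \<open>nu_k^2 + m nu_k - 1\<close>, with
  \<open>a\<close>, \<open>F\<close>, \<open>G\<close> standing for \<open>a_{k,k+1}\<close>,
  \<open>f_k\<close>, \<open>f_{k+1}\<close>.\<close>

lemma quadratic_identity:
  "r\<^sup>2 / l * (r\<^sup>2 / l * a + m / r ^ (k + 2) * G)
    + m / r ^ (k + 2) * (F + (m * r / l - m) * G + a * r ^ (k + 1) * (r ^ 4 / l\<^sup>2 + m * r\<^sup>2 / l - 1))
    + m * (r\<^sup>2 / l * a + m / r ^ (k + 2) * G) - a =
   m * ((F + G / l) / r ^ (k + 2) + a * ((1 / l\<^sup>2 + m / l - 1) / m - 1 / r - r / l\<^sup>2))"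
proof -
  define q y where "q = 1 / r ^ (k + 2)" and "y = 1 / l"
  have *: "r\<^sup>2 / l = r\<^sup>2 * y" "m * r / l = m * r * y" "r ^ 4 / l\<^sup>2 = r ^ 4 * y\<^sup>2" "m * r\<^sup>2 / l = m * r\<^sup>2 * y"
    "m / r ^ (k + 2) = m * q" "(F + G / l) / r ^ (k + 2) = (F + G * y) * q" "1 / l\<^sup>2 = y\<^sup>2" "r / l\<^sup>2 = r * y\<^sup>2"
    "m / l = m * y"
    by (simp_all add: y_def q_def power_divide)
  have q: "q * r ^ (k + 1) = 1 / r" using r by (simp add: q_def)
  have e1: "m * (a * ((y\<^sup>2 + m * y - 1) / m - 1 / r - r * y\<^sup>2)) = a * (y\<^sup>2 + m * y - 1) - m * a * (1 / r + r * y\<^sup>2)"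
    using m_nz by (simp add: algebra_simps)
  have e2: "m * q * (a * r ^ (k + 1) * Q) = (1 / r) * m * a * Q" for Q
    unfolding q[symmetric] by (simp only: mult_ac)
  \<comment> \<open>With \<open>s = 1 / r\<close> and \<open>m = s - r\<close> every cancellation is
    a consequence of \<open>s r = 1\<close>; the identities \<open>h\<close> are the instances
    needed.\<close>
  obtain s where s: "1 / r = s" "s * r = 1" using r by simp
  have ms: "m = s - r" using s by (simp add: bmw_m_def)
  have h: "1 + s * m = s\<^sup>2" "r\<^sup>2 + m * r = 1" "s\<^sup>2 * r ^ 4 = r\<^sup>2" "s\<^sup>2 * r\<^sup>2 = 1" "1 - m * r = r\<^sup>2"
  proof -
    have "s\<^sup>2 * r ^ 4 = (s * r)\<^sup>2 * r\<^sup>2" "s\<^sup>2 * r\<^sup>2 = (s * r)\<^sup>2"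
      by (simp_all add: power_numeral_reduce mult_ac)
    then show "s\<^sup>2 * r ^ 4 = r\<^sup>2" "s\<^sup>2 * r\<^sup>2 = 1" by (simp_all add: s(2))
  qed (use s(2) in \<open>simp_all add: ms algebra_simps power2_eq_square\<close>)
  have "r\<^sup>2 * y * (r\<^sup>2 * y * a + m * q * G) + (m * q * (F + (m * r * y - m) * G) + s * m * a * (r ^ 4 * y\<^sup>2 + m * r\<^sup>2 * y - 1))
      + m * (r\<^sup>2 * y * a + m * q * G) - a
    = m * q * F + m * q * G * y * (r\<^sup>2 + m * r) + a * (1 + s * m) * (r ^ 4 * y\<^sup>2 + m * r\<^sup>2 * y - 1)"
    by (simp add: algebra_simps power_numeral_reduce)
  also have "\<dots> = m * q * F + m * q * G * y + a * (s\<^sup>2 * r ^ 4 * y\<^sup>2 + s\<^sup>2 * r\<^sup>2 * m * y - s\<^sup>2)"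
    unfolding h(1,2) by (simp add: algebra_simps power_numeral_reduce)
  also have "\<dots> = m * ((F + G * y) * q) + a * ((1 - m * r) * y\<^sup>2 + m * y - (1 + s * m))"
    unfolding h(1,3-5) by (simp add: algebra_simps power_numeral_reduce)
  also have "\<dots> = m * ((F + G * y) * q) + (a * (y\<^sup>2 + m * y - 1) - m * a * (s + r * y\<^sup>2))"
    by (simp add: algebra_simps power_numeral_reduce)
  finally have "r\<^sup>2 * y * (r\<^sup>2 * y * a + m * q * G) + (m * q * (F + (m * r * y - m) * G) + s * m * a * (r ^ 4 * y\<^sup>2 + m * r\<^sup>2 * y - 1))
      + m * (r\<^sup>2 * y * a + m * q * G) - a =
    m * ((F + G * y) * q) + (a * (y\<^sup>2 + m * y - 1) - m * a * (s + r * y\<^sup>2))" .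
  then show ?thesis
    unfolding * distrib_left[of m "(F + G * y) * q"] distrib_left[of "m * q" "F + _"] s(1) e1[unfolded s(1)] e2[unfolded s(1)] .
qed

text \<open>The roots of \<open>X^2 + m X - 1\<close> are \<open>r\<close> and \<open>-1/r\<close>;
  the first is the factor by which \<open>nu_k\<close> scales coordinates away from \<open>k\<close>
  and \<open>k+1\<close>.\<close>

lemma hecke: "r * (r * a) + m * (r * a) = a"
proof -
  have "r * (r * a) + m * (r * a) = (r\<^sup>2 + m * r) * a"
    by (simp add: algebra_simps power2_eq_square)
  then show ?thesis by (simp add: m_r)
qed

text \<open>Away from the entry \<open>(k, k+1)\<close>, \<open>nu_k\<close> scales a coordinate by
  \<open>r\<close> or acts on a pair of coordinates by \<open>(x, y) -> (y, x - m y)\<close>. Both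
  satisfy \<open>X^2 + m X - 1 = 0\<close>, so only a multiple of \<open>w_{k,k+1}\<close>
  remains.\<close>

lemma nu_quadratic:
  assumes "1 \<le> k" "k < n" and v: "v \<in> lk_carrier n l r"
  shows "nu l r k (nu l r k v) + lk_scale m (nu l r k v) - v = lk_scale (m * eps k v) (lk_w k (Suc k))"
proof (rule poly_mapping_eqI)
  have carr: "nu l r k (nu l r k v) + lk_scale m (nu l r k v) - v \<in> lk_carrier n l r"
    using assms by (intro lk_carrier_add lk_carrier_diff lk_carrier_scale lk_carrier_nu ground_m)
  fix p
  show "Poly_Mapping.lookup (nu l r k (nu l r k v) + lk_scale m (nu l r k v) - v) p =
    Poly_Mapping.lookup (lk_scale (m * eps k v) (lk_w k (Suc k))) p"
  proof (cases "p \<in> lk_index n")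
    case False
    then have "p \<notin> Poly_Mapping.keys (nu l r k (nu l r k v) + lk_scale m (nu l r k v) - v)"
      using carr by (auto simp: lk_carrier_iff)
    moreover have "p \<noteq> (k, Suc k)" using False assms(1,2) by (auto simp: lk_index_def)
    ultimately show ?thesis by (simp add: in_keys_iff lookup_lk_w)
  next
    case True
    obtain i j where p: "p = (i, j)" by force
    then have ij: "1 \<le> i" "i < j" "j \<le> n" using True by (simp_all add: lk_index_def)
    have k: "i < k \<Longrightarrow> i < Suc k" "Suc k \<le> n" "k \<le> n" "1 \<le> Suc k" using assms(2) by linarith+
    note facts = p lookup_add lookup_minus lookup_lk_scale lookup_lk_w nu_simps ij k assms
    from ij(2) show ?thesis
    proof (cases rule: pair_order_cases[where k = k])
      case A: 4
      show ?thesis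
        by (simp only: A facts) (simp only: quadratic_identity eps_def if_True simp_thms mult_1_right)
    next
      case A: 1
      then have "(i, j) = (k, Suc k) \<longleftrightarrow> False" by auto
      then show ?thesis by (simp only: A facts; simp add: hecke)
    next
      case A: 2
      then have "(i, j) = (k, Suc k) \<longleftrightarrow> False" by auto
      then show ?thesis by (simp only: A facts; simp add: hecke)
    next
      case A: 3
      then have "(i, j) = (k, Suc k) \<longleftrightarrow> False" by auto
      then show ?thesis by (simp only: A facts; simp add: hecke)
    next
      case A: 5
      then have "(i, j) = (k, Suc k) \<longleftrightarrow> False" by auto
      then show ?thesis by (simp only: A facts; simp add: hecke)
    next
      case A: 6
      then have "(i, j) = (k, Suc k) \<longleftrightarrow> False" by auto
      then show ?thesis by (simp only: A facts; simp add: hecke)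
    next
      case A: 7
      then have "(i, j) = (k, Suc k) \<longleftrightarrow> False" by auto
      then show ?thesis by (simp only: A facts; simp add: hecke)
    next
      case A: 8
      then have "(i, j) = (k, Suc k) \<longleftrightarrow> False" by auto
      then show ?thesis by (simp only: A facts; simp add: hecke)
    qed
  qed
qed

text \<open>On \<open>w_{k,k+1}\<close> the functionals contribute \<open>1 / r + r / l^2\<close>,
  which the correction term in \<open>eps\<close> removes. What is left is forced by
  \<open>nu_k w_{k,k+1} = w_{k,k+1} / l\<close>.\<close>

lemma eps_w:
  assumes "1 \<le> k" "k < n"
  shows "eps k (lk_w k (Suc k)) = (1 / l\<^sup>2 + m / l - 1) / m"
    and "\<lbrakk>Suc k < j; j \<le> n\<rbrakk> \<Longrightarrow> eps k (lk_w k j) = r ^ j / r ^ (k + 2)"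
    and "\<lbrakk>Suc k < j; j \<le> n\<rbrakk> \<Longrightarrow> eps k (lk_w (Suc k) j) = r ^ j / l / r ^ (k + 2)"
    and "\<lbrakk>1 \<le> i; i < k\<rbrakk> \<Longrightarrow> eps k (lk_w i k) = r ^ 3 / l * r ^ i / r ^ (k + 2)"
    and "\<lbrakk>1 \<le> i; i < k\<rbrakk> \<Longrightarrow> eps k (lk_w i (Suc k)) = r ^ 3 / l * r ^ i / l / r ^ (k + 2)"
    and "\<lbrakk>1 \<le> i; i < k; Suc k < j; j \<le> n\<rbrakk> \<Longrightarrow> eps k (lk_w i j) = 0"
proof -
  have "r ^ 3 * r ^ k / (l * l * r ^ (k + 2)) = r / l\<^sup>2"
    using r by (simp add: power2_eq_square power3_eq_cube)
  then show "eps k (lk_w k (Suc k)) = (1 / l\<^sup>2 + m / l - 1) / m"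
    using assms r by (simp add: eps_def fsum_w lookup_lk_w add_divide_distrib)
qed (use assms in \<open>simp_all add: eps_def fsum_w lookup_lk_w\<close>)

lemma nu_e:
  assumes "1 \<le> k" "k < n"
  shows "nu l r k (lk_scale c (lk_w k (Suc k))) = lk_scale (inverse l) (lk_scale c (lk_w k (Suc k)))"
  by (simp add: nu_scale nu_w nu_basis_simps lk_scale_scale mult.commute)

section \<open>Invertibility and the action of words\<close>

text \<open>Since \<open>e_i\<close> has image in the line of \<open>w_{i,i+1}\<close>, the relation
  \<open>e_i g_j e_i = l e_i\<close> reduces to the scalar identity
  \<open>eps_i (nu_j w_{i,i+1}) = 1\<close>. This is the case \<open>j = i + 1\<close>;
  \<open>eps_nu_down\<close> is the case \<open>j = i - 1\<close>.\<close>

lemma eps_nu_up: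
  assumes "1 \<le> k" "Suc k < n"
  shows "eps k (nu l r (Suc k) (lk_w k (Suc k))) = 1"
  using assms r by (simp add: nu_w nu_basis_simps eps_w)

lemma eps_nu_down:
  assumes "1 \<le> k" "Suc k < n"
  shows "eps (Suc k) (nu l r k (lk_w (Suc k) (Suc (Suc k)))) = 1"
proof -
  have "nu l r k (lk_w (Suc k) (Suc (Suc k))) =
      lk_w k (Suc (Suc k)) + lk_scale m (lk_w k (Suc k)) - lk_scale m (lk_w (Suc k) (Suc (Suc k)))"
    using nu_basis_simps(3)[of k 0] by (simp add: nu_w)
  moreover have "eps (Suc k) (lk_w k (Suc (Suc k))) = 1 / l\<^sup>2" "eps (Suc k) (lk_w k (Suc k)) = 1 / l"
    using assms r by (simp_all add: eps_w power2_eq_square power3_eq_cube)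
  ultimately show ?thesis using assms m_nz by (simp add: eps_linear eps_w)
qed

text \<open>The product \<open>(X - 1/l)(X^2 + m X - 1)\<close> equals
  \<open>X (X^2 + (m - 1/l) X - (1 + m/l)) + 1/l\<close>. It annihilates \<open>nu_k\<close>, and
  solving for the inverse gives this polynomial in \<open>nu_k\<close>.\<close>

definition nu_inv :: "nat \<Rightarrow> lk_vec \<Rightarrow> lk_vec" where
  "nu_inv k v = lk_scale (- l) (nu l r k (nu l r k v) + lk_scale (m - 1 / l) (nu l r k v) - lk_scale (1 + m / l) v)"

text \<open>The quadratic remainder is a multiple of \<open>w_{k,k+1}\<close>, which
  \<open>nu_k\<close> scales by \<open>1 / l\<close>.\<close>

lemma nu_cubic:
  assumes "1 \<le> k" "k < n" "v \<in> lk_carrier n l r"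
  shows "nu l r k (nu l r k (nu l r k v)) + lk_scale (m - 1 / l) (nu l r k (nu l r k v))
     - lk_scale (1 + m / l) (nu l r k v) = lk_scale (- 1 / l) v"
proof -
  let ?N = "nu l r k"
  define u where "u = ?N (?N v) + lk_scale m (?N v) - v"
  have "?N u = lk_scale (inverse l) u"
    unfolding u_def nu_quadratic[OF assms] by (simp add: nu_scale nu_w nu_basis_simps lk_scale_scale mult.commute)
  then have "?N (?N (?N v)) + lk_scale m (?N (?N v)) - ?N v =
      lk_scale (inverse l) (?N (?N v) + lk_scale m (?N v) - v)"
    by (simp add: u_def nu_add nu_diff nu_scale)
  then have "Poly_Mapping.lookup (?N (?N (?N v)) + lk_scale m (?N (?N v)) - ?N v) p =
      Poly_Mapping.lookup (lk_scale (inverse l) (?N (?N v) + lk_scale m (?N v) - v)) p" for p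
    by simp
  then show ?thesis
    by (intro poly_mapping_eqI) (simp add: lookup_add lookup_minus divide_inverse algebra_simps)
qed

lemma lk_carrier_nu_inv:
  assumes "1 \<le> k" "k < n" "v \<in> lk_carrier n l r"
  shows "nu_inv k v \<in> lk_carrier n l r"
  unfolding nu_inv_def using assms
  by (intro lk_carrier_add lk_carrier_diff lk_carrier_scale lk_carrier_nu ground_intros)

lemma nu_inv_right:
  assumes "1 \<le> k" "k < n" "v \<in> lk_carrier n l r"
  shows "nu l r k (nu_inv k v) = v"
  using l by (simp add: nu_inv_def nu_scale nu_add nu_diff nu_cubic[OF assms] lk_scale_scale lk_scale_one)

lemma nu_inv_left:
  assumes "1 \<le> k" "k < n" "v \<in> lk_carrier n l r"
  shows "nu_inv k (nu l r k v) = v"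
  using l by (simp add: nu_inv_def nu_cubic[OF assms] lk_scale_scale lk_scale_one)

lemma inv_into_nu:
  assumes "1 \<le> k" "k < n" "v \<in> lk_carrier n l r"
  shows "inv_into (lk_carrier n l r) (nu l r k) v = nu_inv k v"
proof (rule inv_into_f_eq)
  show "inj_on (nu l r k) (lk_carrier n l r)"
    using nu_inv_left[OF assms(1,2)] by (rule inj_on_inverseI)
qed (use assms lk_carrier_nu_inv nu_inv_right in auto)

text \<open>Inverse letters and algebra elements are absent on purpose:
  \<open>nu_stable_nu_inv\<close> recovers the former, because \<open>nu_inv\<close> is a polynomial
  in \<open>nu_k\<close> over F.\<close>

definition nu_stable :: "lk_vec set \<Rightarrow> bool" where
  "nu_stable W \<longleftrightarrow> W \<subseteq> lk_carrier n l r \<and> 0 \<in> W \<and> (\<forall>u\<in>W. \<forall>v\<in>W. u + v \<in> W)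
     \<and> (\<forall>c\<in>ground_set l r. \<forall>v\<in>W. lk_scale c v \<in> W) \<and> (\<forall>k. 1 \<le> k \<longrightarrow> k < n \<longrightarrow> (\<forall>v\<in>W. nu l r k v \<in> W))"

lemma nu_stableD:
  assumes "nu_stable W"
  shows "v \<in> W \<Longrightarrow> v \<in> lk_carrier n l r" "0 \<in> W"
    and "u \<in> W \<Longrightarrow> v \<in> W \<Longrightarrow> u + v \<in> W"
    and "c \<in> ground_set l r \<Longrightarrow> v \<in> W \<Longrightarrow> lk_scale c v \<in> W"
    and "1 \<le> k \<Longrightarrow> k < n \<Longrightarrow> v \<in> W \<Longrightarrow> nu l r k v \<in> W"
    and "u \<in> W \<Longrightarrow> v \<in> W \<Longrightarrow> u - v \<in> W"
proof -
  show *: "u \<in> W \<Longrightarrow> v \<in> W \<Longrightarrow> u + v \<in> W" "c \<in> ground_set l r \<Longrightarrow> v \<in> W \<Longrightarrow> lk_scale c v \<in> W" for u v c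
    using assms by (auto simp: nu_stable_def)
  show "u - v \<in> W" if "u \<in> W" "v \<in> W"
    using *(1)[OF that(1) *(2)[of "- 1" v, OF _ that(2)]] by (simp add: lk_scale_minus_one ground_intros)
qed (use assms in \<open>auto simp: nu_stable_def\<close>)

lemma nu_stable_sum:
  assumes "nu_stable W" "\<And>i. i \<in> A \<Longrightarrow> f i \<in> W"
  shows "sum f A \<in> W"
  using assms(2) by (induction A rule: infinite_finite_induct) (auto intro: nu_stableD[OF assms(1)])

lemma nu_stable_carrier: "nu_stable (lk_carrier n l r)"
  by (auto simp: nu_stable_def lk_carrier_zero intro: lk_carrier_add lk_carrier_scale lk_carrier_nu)

lemma nu_stable_nu_inv:
  assumes "nu_stable W" "1 \<le> k" "k < n" "v \<in> W"
  shows "nu_inv k v \<in> W"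
  unfolding nu_inv_def using assms(2-)
  by (intro nu_stableD[OF assms(1)] ground_intros)

abbreviation act :: "letter \<Rightarrow> lk_vec \<Rightarrow> lk_vec" where "act \<equiv> letter_action n l r"

lemma act_stable:
  assumes "nu_stable W" "letter_index x \<in> {1..n - 1}" "v \<in> W"
  shows "act x v \<in> W"
proof -
  have k: "1 \<le> letter_index x" "letter_index x < n" using assms(2) by auto
  show ?thesis
    using k nu_stableD(5)[OF assms(1) k assms(3)] nu_stable_nu_inv[OF assms(1) k assms(3)]
      inv_into_nu[OF k nu_stableD(1)[OF assms(1,3)]]
    by (cases x) (simp_all add: lk_carrier_def)
qed

text \<open>An inverse letter acts by \<open>inv_into\<close>, which is controlled only on the
  carrier. This is why linearity is restricted to carrier vectors and to scalars in F, here and for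
  words.\<close>

lemma act_linear:
  assumes "letter_index x \<in> {1..n - 1}" "u \<in> lk_carrier n l r" "v \<in> lk_carrier n l r"
  shows "act x (u + v) = act x u + act x v"
    and "c \<in> ground_set l r \<Longrightarrow> act x (lk_scale c v) = lk_scale c (act x v)"
proof -
  have "nu_inv k (u + v) = nu_inv k u + nu_inv k v" "nu_inv k (lk_scale c v) = lk_scale c (nu_inv k v)" for k c
    by (rule poly_mapping_eqI; simp add: nu_inv_def nu_add nu_scale lookup_add lookup_minus algebra_simps)+
  then show "act x (u + v) = act x u + act x v"
    and "c \<in> ground_set l r \<Longrightarrow> act x (lk_scale c v) = lk_scale c (act x v)"
    using assms
    by (cases x; auto simp: lk_carrier_def[symmetric] inv_into_nu nu_add nu_scale lk_carrier_add lk_carrier_scale)+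
qed

definition valid_word :: "word \<Rightarrow> bool" where
  "valid_word w \<longleftrightarrow> (\<forall>x \<in> set (letters w). letter_index x \<in> {1..n - 1})"

abbreviation wact :: "word \<Rightarrow> lk_vec \<Rightarrow> lk_vec" where "wact \<equiv> word_action n l r"

lemma wact_stable: "nu_stable W \<Longrightarrow> valid_word w \<Longrightarrow> v \<in> W \<Longrightarrow> wact w v \<in> W"
proof (cases w)
  case (Word xs)
  show "nu_stable W \<Longrightarrow> valid_word w \<Longrightarrow> v \<in> W \<Longrightarrow> wact w v \<in> W"
    unfolding Word word_action_def valid_word_def
    by (induction xs) (auto intro!: act_stable)
qed

lemma wact_carrier: "valid_word w \<Longrightarrow> v \<in> lk_carrier n l r \<Longrightarrow> wact w v \<in> lk_carrier n l r"
  by (rule wact_stable[OF nu_stable_carrier])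

lemma wact_Cons: "wact (Word (x # xs)) v = act x (wact (Word xs) v)"
  by (simp add: word_action_def)

lemma wact_linear:
  assumes "valid_word w" "u \<in> lk_carrier n l r" "v \<in> lk_carrier n l r"
  shows "wact w (u + v) = wact w u + wact w v"
    and "c \<in> ground_set l r \<Longrightarrow> wact w (lk_scale c v) = lk_scale c (wact w v)"
proof -
  obtain xs where w: "w = Word xs" by (cases w)
  have "wact (Word xs) (u + v) = wact (Word xs) u + wact (Word xs) v \<and>
    (c \<in> ground_set l r \<longrightarrow> wact (Word xs) (lk_scale c v) = lk_scale c (wact (Word xs) v))" for c
    using assms(1) unfolding w
  proof (induction xs)
    case Nil then show ?case by (simp add: word_action_def)
  next
    case (Cons x xs)
    then have "valid_word (Word xs)" "letter_index x \<in> {1..n - 1}" by (auto simp: valid_word_def)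
    with Cons.IH show ?case unfolding wact_Cons
      using act_linear[of x] wact_carrier assms(2,3) by simp
  qed
  then show "wact w (u + v) = wact w u + wact w v"
    and "c \<in> ground_set l r \<Longrightarrow> wact w (lk_scale c v) = lk_scale c (wact w v)" by (auto simp: w)
qed

lemma wact_plus: "wact (u + w) v = wact u (wact w v)"
  by (simp add: word_action_def plus_word_def)

lemma wact_zero: "wact 0 v = v"
  by (simp add: word_action_def zero_word_def)

lemma wact_sum:
  assumes "valid_word w" "\<And>i. i \<in> A \<Longrightarrow> f i \<in> lk_carrier n l r"
  shows "wact w (\<Sum>i\<in>A. f i) = (\<Sum>i\<in>A. wact w (f i))"
  using assms(2)
proof (induction A rule: infinite_finite_induct)
  case (insert x F)
  then show ?case using wact_linear(1)[OF assms(1)] by (simp add: lk_carrier_sum)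
qed (use wact_linear(2)[OF assms(1), of 0 0 0] in \<open>simp_all add: lk_scale_zero_left lk_carrier_zero ground_zero\<close>)

section \<open>The action of the free algebra and of the BMW algebra\<close>

definition falg :: "(word \<Rightarrow>\<^sub>0 complex) set" where
  "falg = carrier (free_algebra n l r)"

lemma falg_iff: "p \<in> falg \<longleftrightarrow>
  (\<forall>w. Poly_Mapping.lookup p w \<in> ground_set l r) \<and> (\<forall>w\<in>Poly_Mapping.keys p. valid_word w)"
  by (simp add: falg_def free_algebra_def valid_word_def)

lemma falg_single: "c \<in> ground_set l r \<Longrightarrow> valid_word w \<Longrightarrow> Poly_Mapping.single w c \<in> falg"
  by (auto simp: falg_iff lookup_single when_def ground_zero)

lemma falg_zero: "0 \<in> falg"
  by (simp add: falg_iff ground_zero)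

lemma falg_add: "p \<in> falg \<Longrightarrow> q \<in> falg \<Longrightarrow> p + q \<in> falg"
  using keys_add[of p q] by (auto simp: falg_iff lookup_add intro: ground_add)

lemma falg_uminus: "p \<in> falg \<Longrightarrow> - p \<in> falg"
  by (auto simp: falg_iff in_keys_iff intro: ground_uminus)

lemma falg_diff: "p \<in> falg \<Longrightarrow> q \<in> falg \<Longrightarrow> p - q \<in> falg"
  using falg_add[of p "- q"] falg_uminus by simp

lemma falg_sum: "(\<And>i. i \<in> I \<Longrightarrow> f i \<in> falg) \<Longrightarrow> sum f I \<in> falg"
  by (induction I rule: infinite_finite_induct) (auto intro: falg_zero falg_add)

lemma valid_word_zero: "valid_word 0"
  by (simp add: valid_word_def zero_word_def)

lemma valid_word_plus: "valid_word u \<Longrightarrow> valid_word w \<Longrightarrow> valid_word (u + w)"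
  by (auto simp: valid_word_def plus_word_def)

lemma falg_mult: "p \<in> falg \<Longrightarrow> q \<in> falg \<Longrightarrow> p * q \<in> falg"
  unfolding mult_expand[of p q]
  by (intro falg_sum falg_single ground_mult valid_word_plus) (auto simp: falg_iff)

lemma falg_scal: "c \<in> ground_set l r \<Longrightarrow> scal c \<in> falg"
  unfolding scal_def by (intro falg_single valid_word_zero)

lemma falg_one: "1 \<in> falg"
  using falg_scal[OF ground_one] by (simp add: scal_def)

lemma falg_gen: "k \<in> {1..n - 1} \<Longrightarrow> gen k \<in> falg" "k \<in> {1..n - 1} \<Longrightarrow> gen_inv k \<in> falg"
  unfolding gen_def gen_inv_def by (auto intro!: falg_single ground_one simp: valid_word_def)

text \<open>\<open>falg\<close> is closed under the operations of the convolution ring of all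
  finitely supported complex functions on words, so the ring axioms are inherited from
  there.\<close>

lemma ring_free_algebra: "ring (free_algebra n l r)"
proof -
  let ?R = "ring_of_type_algebra :: (word \<Rightarrow>\<^sub>0 complex) ring"
  interpret R: ring ?R by (rule ring_ring_of_type_algebra)
  have "subring falg ?R"
  proof (rule R.subringI)
    show "\<ominus>\<^bsub>?R\<^esub> h \<in> falg" if "h \<in> falg" for h
    proof -
      have "\<ominus>\<^bsub>?R\<^esub> h = - h"
        by (rule R.minus_equality) (simp_all add: ring_of_type_algebra_def)
      then show ?thesis using falg_uminus[OF that] by simp
    qed
  qed (auto simp: ring_of_type_algebra_def falg_one intro: falg_add falg_mult)
  then have "ring (?R\<lparr>carrier := falg\<rparr>)" by (rule R.subring_is_ring)
  then show ?thesis by (simp add: falg_def free_algebra_def)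
qed

abbreviation pact :: "(word \<Rightarrow>\<^sub>0 complex) \<Rightarrow> lk_vec \<Rightarrow> lk_vec" where
  "pact \<equiv> free_action n l r"

lemma free_action_superset:
  assumes "finite S" "Poly_Mapping.keys p \<subseteq> S"
  shows "pact p v = (\<Sum>w\<in>S. lk_scale (Poly_Mapping.lookup p w) (wact w v))"
  unfolding free_action_def
  using assms by (intro sum.mono_neutral_left) (auto simp: in_keys_iff lk_scale_zero_left)

lemma free_action_add: "pact (p + q) v = pact p v + pact q v"
proof -
  let ?S = "Poly_Mapping.keys p \<union> Poly_Mapping.keys q"
  have "Poly_Mapping.keys (p + q) \<subseteq> ?S" by (rule keys_add)
  then show ?thesis
    by (simp add: free_action_superset[of ?S] lookup_add lk_scale_add_left sum.distrib)
qed

lemma free_action_zero: "pact 0 v = 0"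
  by (simp add: free_action_def)

lemma free_action_diff: "pact (p - q) v = pact p v - pact q v"
  using free_action_add[of "p - q" q v] by (simp add: algebra_simps)

lemma free_action_sum: "pact (\<Sum>i\<in>I. f i) v = (\<Sum>i\<in>I. pact (f i) v)"
  by (induction I rule: infinite_finite_induct) (simp_all add: free_action_zero free_action_add)

lemma free_action_single: "pact (Poly_Mapping.single w c) v = lk_scale c (wact w v)"
  by (cases "c = 0") (simp_all add: free_action_def lk_scale_zero_left)

lemma free_action_scal: "pact (scal c) v = lk_scale c v"
  by (simp add: scal_def free_action_single wact_zero)

lemma free_action_one: "pact 1 v = v"
  using free_action_scal[of 1 v] by (simp add: scal_def lk_scale_one)

lemma free_action_gen: "pact (gen k) v = nu l r k v"
  by (simp add: gen_def free_action_single word_action_def lk_scale_one)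

lemma free_action_gen_inv:
  assumes "k \<in> {1..n - 1}" "v \<in> lk_carrier n l r"
  shows "pact (gen_inv k) v = nu_inv k v"
proof -
  have "1 \<le> k" "k < n" using assms(1) by auto
  from inv_into_nu[OF this assms(2)] show ?thesis
    by (simp add: gen_inv_def free_action_single word_action_def lk_scale_one lk_carrier_def)
qed

lemma free_action_stable:
  assumes "nu_stable W" "p \<in> falg" "v \<in> W"
  shows "pact p v \<in> W"
  unfolding free_action_def using assms(2,3)
  by (intro nu_stable_sum[OF assms(1)] nu_stableD(4)[OF assms(1)] wact_stable[OF assms(1)]) (auto simp: falg_iff)

lemma free_action_carrier: "p \<in> falg \<Longrightarrow> v \<in> lk_carrier n l r \<Longrightarrow> pact p v \<in> lk_carrier n l r"
  by (rule free_action_stable[OF nu_stable_carrier])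

lemma free_action_mult:
  assumes p: "p \<in> falg" and q: "q \<in> falg" and v: "v \<in> lk_carrier n l r"
  shows "pact (p * q) v = pact p (pact q v)"
proof -
  have "wact u (pact q v) =
      (\<Sum>w\<in>Poly_Mapping.keys q. lk_scale (Poly_Mapping.lookup q w) (wact (u + w) v))"
    if "u \<in> Poly_Mapping.keys p" for u
  proof -
    have u: "valid_word u" using p that by (simp add: falg_iff)
    have w: "wact w v \<in> lk_carrier n l r" if "w \<in> Poly_Mapping.keys q" for w
      using q that v by (intro wact_carrier) (auto simp: falg_iff)
    have c: "Poly_Mapping.lookup q w \<in> ground_set l r" for w using q by (simp add: falg_iff)
    show ?thesis
      unfolding free_action_def
      by (subst wact_sum[OF u]) (auto simp: w c u wact_linear(2)[OF u w w] wact_plus intro!: lk_carrier_scale sum.cong)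
  qed
  then show ?thesis
    unfolding mult_expand[of p q] free_action_sum free_action_single
    by (simp add: free_action_def[of n l r p] lk_scale_sum_right lk_scale_scale)
qed

lemma falg_e_elem: "k \<in> {1..n - 1} \<Longrightarrow> e_elem l r k \<in> falg"
  unfolding e_elem_def power2_eq_square
  by (intro falg_mult falg_add falg_diff falg_scal falg_one falg_gen ground_intros)

lemma free_action_e_elem:
  assumes k: "k \<in> {1..n - 1}" and v: "v \<in> lk_carrier n l r"
  shows "pact (e_elem l r k) v = lk_scale (l * eps k v) (lk_w k (Suc k))"
proof -
  have k': "1 \<le> k" "k < n" using k by auto
  have "pact (scal m * gen k) v = lk_scale m (nu l r k v)"
    using k v by (simp add: free_action_mult falg_scal falg_gen ground_m free_action_scal free_action_gen)
  then have "pact (e_elem l r k) v = lk_scale (l / m) (nu l r k (nu l r k v) + lk_scale m (nu l r k v) - v)"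
    unfolding e_elem_def power2_eq_square using k v
    by (subst free_action_mult)
       (auto simp: free_action_mult free_action_diff free_action_add free_action_scal free_action_gen free_action_one
          falg_gen falg_scal lk_carrier_nu k' intro!: falg_mult falg_add falg_diff falg_scal falg_one falg_gen ground_intros)
  then show ?thesis using m_nz by (simp add: nu_quadratic[OF k' v] lk_scale_scale)
qed

text \<open>The kernel of the free action. It is a two-sided ideal containing the relators, hence it
  contains the ideal they generate; this makes the action of a coset independent of the
  representative.\<close>

definition annihilator :: "(word \<Rightarrow>\<^sub>0 complex) set" where
  "annihilator = {p \<in> falg. \<forall>v\<in>lk_carrier n l r. pact p v = 0}"

lemma ideal_annihilator: "ideal annihilator (free_algebra n l r)"
proof (rule idealI[OF ring_free_algebra])
  interpret R: ring "free_algebra n l r" by (rule ring_free_algebra)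
  have ops: "x \<otimes>\<^bsub>free_algebra n l r\<^esub> y = x * y" "x \<oplus>\<^bsub>free_algebra n l r\<^esub> y = x + y"
    "\<zero>\<^bsub>free_algebra n l r\<^esub> = 0" for x y
    by (simp_all add: free_algebra_def ring_of_type_algebra_def)
  have minus: "\<ominus>\<^bsub>free_algebra n l r\<^esub> x = - x" if "x \<in> falg" for x
    by (rule R.minus_equality) (use that falg_uminus in \<open>simp_all add: ops falg_def[symmetric]\<close>)
  show "subgroup annihilator (add_monoid (free_algebra n l r))"
  proof (rule R.add.subgroupI)
    show "annihilator \<subseteq> carrier (free_algebra n l r)" by (auto simp: annihilator_def falg_def)
    show "annihilator \<noteq> {}" using falg_zero free_action_zero by (auto simp: annihilator_def)
    show "\<ominus>\<^bsub>free_algebra n l r\<^esub> a \<in> annihilator" if "a \<in> annihilator" for a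
      using that free_action_diff[of 0 a] falg_uminus by (auto simp: annihilator_def minus free_action_zero)
    show "a \<oplus>\<^bsub>free_algebra n l r\<^esub> b \<in> annihilator" if "a \<in> annihilator" "b \<in> annihilator" for a b
      using that falg_add by (auto simp: annihilator_def ops free_action_add)
  qed
  fix a x assume a: "a \<in> annihilator" and "x \<in> carrier (free_algebra n l r)"
  then have x: "x \<in> falg" by (simp add: falg_def)
  have "pact x 0 = 0" using free_action_mult[OF x falg_zero lk_carrier_zero] by (simp add: free_action_zero)
  then show "x \<otimes>\<^bsub>free_algebra n l r\<^esub> a \<in> annihilator"
    using a x falg_mult by (auto simp: annihilator_def ops free_action_mult)
  show "a \<otimes>\<^bsub>free_algebra n l r\<^esub> x \<in> annihilator"
    using a x falg_mult free_action_carrier[OF x] by (auto simp: annihilator_def ops free_action_mult)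
qed

lemma annihilatorI:
  assumes "p \<in> falg" "q \<in> falg" "\<And>v. v \<in> lk_carrier n l r \<Longrightarrow> pact p v = pact q v"
  shows "p - q \<in> annihilator"
  using assms by (simp add: annihilator_def falg_diff free_action_diff)

lemma bmw_relators_annihilator: "bmw_relators n l r \<subseteq> annihilator"
proof -
  note alg = falg_mult falg_scal falg_one falg_gen falg_e_elem ground_intros
  note acts = free_action_mult free_action_scal free_action_one free_action_gen free_action_gen_inv
    free_action_e_elem lk_carrier_nu lk_carrier_nu_inv
  have bounds: "1 \<le> i" "i < n" if "i \<in> {1..n - 1}" for i using that by auto
  have 1: "gen i * gen_inv i - 1 \<in> annihilator" if "i \<in> {1..n - 1}" for i
    using that bounds[OF that]
    by (intro annihilatorI) (simp_all add: alg acts nu_inv_right)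
  have 8: "gen_inv i * gen i - 1 \<in> annihilator" if "i \<in> {1..n - 1}" for i
    using that bounds[OF that]
    by (intro annihilatorI) (simp_all add: alg acts nu_inv_left)
  have 2: "gen i * gen j - gen j * gen i \<in> annihilator"
    if "i \<in> {1..n - 1}" "j \<in> {1..n - 1}" "i + 2 \<le> j \<or> j + 2 \<le> i" for i j
  proof (rule annihilatorI)
    fix v assume v: "v \<in> lk_carrier n l r"
    have "nu l r i (nu l r j v) = nu l r j (nu l r i v)"
      using that(3) nu_commute[OF bounds(1)[OF that(1)] _ bounds(2)[OF that(2)] v]
        nu_commute[OF bounds(1)[OF that(2)] _ bounds(2)[OF that(1)] v] by auto
    then show "pact (gen i * gen j) v = pact (gen j * gen i) v"
      using that(1,2) v by (simp add: alg acts)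
  qed (use that(1,2) in \<open>simp_all add: alg\<close>)
  have 3: "gen i * gen (i + 1) * gen i - gen (i + 1) * gen i * gen (i + 1) \<in> annihilator"
    if i: "i \<in> {1..n - 1}" "i + 1 \<in> {1..n - 1}" for i
    using nu_braid[of i] bounds[OF i(1)] bounds[OF i(2)] i
    by (intro annihilatorI) (simp_all add: alg acts)
  have 4: "gen i * e_elem l r i - scal (inverse l) * e_elem l r i \<in> annihilator" if i: "i \<in> {1..n - 1}" for i
    using bounds[OF i] i
    by (intro annihilatorI) (simp_all add: alg acts nu_e)
  have 5: "e_elem l r i * gen j * e_elem l r i - scal l * e_elem l r i \<in> annihilator"
    if i: "i \<in> {1..n - 1}" and j: "j \<in> {1..n - 1}" and "eps i (nu l r j (lk_w i (Suc i))) = 1" for i j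
  proof (rule annihilatorI)
    fix v assume v: "v \<in> lk_carrier n l r"
    have "lk_w i (Suc i) \<in> lk_carrier n l r" using bounds[OF i] by (intro lk_carrier_w) auto
    moreover have "eps i v \<in> ground_set l r"
      using v unfolding eps_def fsum_def lk_carrier_iff by (auto intro!: ground_intros)
    ultimately show "pact (e_elem l r i * gen j * e_elem l r i) v = pact (scal l * e_elem l r i) v"
      using v i j bounds[OF j] that(3)
      by (simp add: alg acts lk_carrier_scale nu_scale eps_scale lk_scale_scale mult_ac)
  qed (use i j in \<open>simp_all add: alg\<close>)
  have 6: "e_elem l r i * gen (i + 1) * e_elem l r i - scal l * e_elem l r i \<in> annihilator"
    if "i \<in> {1..n - 1}" "i + 1 \<in> {1..n - 1}" for i
    using that by (intro 5) (auto simp: eps_nu_up)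
  have 7: "e_elem l r i * gen (i - 1) * e_elem l r i - scal l * e_elem l r i \<in> annihilator"
    if i: "i \<in> {1..n - 1}" "i - 1 \<in> {1..n - 1}" for i
  proof (rule 5[OF i])
    obtain k where "i = Suc k" "1 \<le> k" using i by (cases i) auto
    then show "eps i (nu l r (i - 1) (lk_w i (Suc i))) = 1"
      using eps_nu_down[of k] i by simp
  qed
  show ?thesis unfolding bmw_relators_def using 1 8 2 3 4 6 7 by blast
qed

text \<open>\<open>the_elem\<close> is meaningful because the image of the coset is a singleton:
  elements of the ideal act as 0, and the ideal contains 0.\<close>

lemma lk_rep_coset:
  assumes p: "p \<in> falg" and v: "v \<in> lk_carrier n l r"
  shows "lk_rep n l r (genideal (free_algebra n l r) (bmw_relators n l r) +>\<^bsub>free_algebra n l r\<^esub> p) v = pact p v"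
proof -
  interpret R: ring "free_algebra n l r" by (rule ring_free_algebra)
  let ?I = "genideal (free_algebra n l r) (bmw_relators n l r)"
  have sub: "?I \<subseteq> annihilator"
    by (rule R.genideal_minimal[OF ideal_annihilator bmw_relators_annihilator])
  have "bmw_relators n l r \<subseteq> carrier (free_algebra n l r)"
    using bmw_relators_annihilator by (auto simp: annihilator_def falg_def)
  from R.genideal_ideal[OF this] interpret I: ideal ?I "free_algebra n l r" .
  have coset: "?I +>\<^bsub>free_algebra n l r\<^esub> p = (\<lambda>h. h + p) ` ?I"
    by (auto simp: a_r_coset_def' free_algebra_def ring_of_type_algebra_def)
  have "pact (h + p) v = pact p v" if "h \<in> ?I" for h
    using subsetD[OF sub that] v by (simp add: free_action_add annihilator_def)
  then have "(\<lambda>h. pact (h + p) v) ` ?I = (\<lambda>h. pact p v) ` ?I"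
    by (rule image_cong[OF refl])
  also have "\<dots> = {pact p v}" using I.zero_closed by (simp only: image_constant)
  finally show ?thesis by (simp add: lk_rep_def coset image_image)
qed

lemma submodule_iff:
  "submodule W (ground_field l r) (lk_space n l r) \<longleftrightarrow>
    W \<subseteq> lk_carrier n l r \<and> 0 \<in> W \<and> (\<forall>u\<in>W. \<forall>v\<in>W. u + v \<in> W) \<and> (\<forall>c\<in>ground_set l r. \<forall>v\<in>W. lk_scale c v \<in> W)"
  (is "?L \<longleftrightarrow> ?R")
proof
  assume ?L
  then interpret W: submodule W "ground_field l r" "lk_space n l r" .
  from W.subset W.one_closed W.m_closed W.smult_closed show ?R
    by (auto simp: lk_carrier_def lk_space_def ground_field_def)
next
  assume R: ?R
  let ?M = "add_monoid (lk_space n l r)"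
  have ops: "x \<oplus>\<^bsub>lk_space n l r\<^esub> y = x + y" "\<zero>\<^bsub>lk_space n l r\<^esub> = 0"
    "carrier (lk_space n l r) = lk_carrier n l r" "c \<odot>\<^bsub>lk_space n l r\<^esub> x = lk_scale c x" for x y c
    by (simp_all add: lk_space_def lk_carrier_def)
  have neg: "- v \<in> lk_carrier n l r" if "v \<in> lk_carrier n l r" for v
    using lk_carrier_diff[OF lk_carrier_zero that] by simp
  interpret M: group ?M
    by (rule groupI) (auto simp: ops add.assoc lk_carrier_zero intro: lk_carrier_add intro!: bexI[OF _ neg])
  have inv: "inv\<^bsub>?M\<^esub> v = - v" if "v \<in> lk_carrier n l r" for v
    by (rule M.inv_equality) (use that neg in \<open>simp_all add: ops\<close>)
  show ?L
  proof (intro submodule.intro submodule_axioms.intro M.subgroupI)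
    show "inv\<^bsub>?M\<^esub> a \<in> W" if "a \<in> W" for a
    proof -
      have "- 1 \<in> ground_set l r" by (intro ground_uminus ground_one)
      then have "lk_scale (- 1) a \<in> W" using R that by blast
      then show ?thesis using R that inv[of a] by (auto simp: lk_scale_minus_one)
    qed
  qed (use R in \<open>auto simp: ops ground_field_def\<close>)
qed

text \<open>The cosets of the generators act as the \<open>nu_k\<close>, and conversely every coset
  acts by an F-combination of words in the \<open>nu_k\<close> and their inverses. From here on the
  algebra plays no part in the arguments, only \<open>nu_stable\<close> subspaces do.\<close>

theorem lk_irreducible_iff:
  "lk_irreducible n l r \<longleftrightarrow> (\<forall>W. nu_stable W \<longrightarrow> W = {0} \<or> W = lk_carrier n l r)"
proof -
  let ?B = "bmw_algebra n l r"
  have carrier: "carrier ?B = (\<lambda>p. genideal (free_algebra n l r) (bmw_relators n l r) +>\<^bsub>free_algebra n l r\<^esub> p) ` falg"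
    by (auto simp: bmw_algebra_def FactRing_def A_RCOSETS_def' falg_def)
  have "(submodule W (ground_field l r) (lk_space n l r) \<and> (\<forall>x\<in>carrier ?B. \<forall>v\<in>W. lk_rep n l r x v \<in> W)) \<longleftrightarrow> nu_stable W" for W
  proof
    assume L: "submodule W (ground_field l r) (lk_space n l r) \<and> (\<forall>x\<in>carrier ?B. \<forall>v\<in>W. lk_rep n l r x v \<in> W)"
    then have W: "W \<subseteq> lk_carrier n l r" by (simp add: submodule_iff)
    have "nu l r k v \<in> W" if "1 \<le> k" "k < n" "v \<in> W" for k v
    proof -
      have k: "gen k \<in> falg" using that by (intro falg_gen) auto
      with L that(3) have "lk_rep n l r (genideal (free_algebra n l r) (bmw_relators n l r) +>\<^bsub>free_algebra n l r\<^esub> gen k) v \<in> W"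
        unfolding carrier by blast
      moreover have "v \<in> lk_carrier n l r" using W that(3) by blast
      ultimately show ?thesis by (simp add: lk_rep_coset[OF k] free_action_gen)
    qed
    then show "nu_stable W" using L unfolding nu_stable_def submodule_iff by blast
  next
    assume W: "nu_stable W"
    then have "submodule W (ground_field l r) (lk_space n l r)"
      unfolding submodule_iff nu_stable_def by blast
    moreover have "lk_rep n l r x v \<in> W" if "x \<in> carrier ?B" "v \<in> W" for x v
      using that free_action_stable[OF W] nu_stableD(1)[OF W] unfolding carrier by (auto simp: lk_rep_coset)
    ultimately show "submodule W (ground_field l r) (lk_space n l r) \<and> (\<forall>x\<in>carrier ?B. \<forall>v\<in>W. lk_rep n l r x v \<in> W)"
      by blast
  qed
  moreover have "\<zero>\<^bsub>lk_space n l r\<^esub> = 0" by (simp add: lk_space_def)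
  ultimately show ?thesis
    unfolding lk_irreducible_def irreducible_rep_def by (simp add: lk_carrier_def)
qed

section \<open>The reducible cases\<close>

definition lk_of :: "(nat \<Rightarrow> nat \<Rightarrow> complex) \<Rightarrow> lk_vec" where
  "lk_of f = (\<Sum>(i, j)\<in>lk_index n. lk_scale (f i j) (lk_w i j))"

lemma lookup_lk_of:
  assumes "1 \<le> i" "i < j" "j \<le> n"
  shows "Poly_Mapping.lookup (lk_of f) (i, j) = f i j"
proof -
  have "Poly_Mapping.lookup (lk_of f) (i, j) = (\<Sum>p\<in>lk_index n. if p = (i, j) then f i j else 0)"
    unfolding lk_of_def lookup_sum by (rule sum.cong) (auto simp: lookup_lk_w split: if_splits)
  also have "\<dots> = f i j" using assms finite_lk_index by (simp add: lk_index_def)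
  finally show ?thesis .
qed

lemma lk_carrier_lk_of:
  assumes "\<And>i j. 1 \<le> i \<Longrightarrow> i < j \<Longrightarrow> j \<le> n \<Longrightarrow> f i j \<in> ground_set l r"
  shows "lk_of f \<in> lk_carrier n l r"
  unfolding lk_of_def using assms
  by (auto simp: lk_index_def intro!: lk_carrier_sum lk_carrier_scale lk_carrier_w)

lemma reducibleI:
  assumes "nu_stable W" "u \<in> W" "u \<noteq> 0" "v \<in> lk_carrier n l r" "v \<notin> W"
  shows "\<not> lk_irreducible n l r"
  using assms unfolding lk_irreducible_iff by blast

lemma nu_stable_fsum_kernel:
  assumes "r ^ 4 / l\<^sup>2 + m * r\<^sup>2 / l - 1 = 0"
  shows "nu_stable {v \<in> lk_carrier n l r. \<forall>i\<in>{1..n}. fsum i v = 0}"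
  unfolding nu_stable_def using assms
  by (auto simp: lk_carrier_zero lk_carrier_add lk_carrier_scale lk_carrier_nu fsum_linear fsum_nu nu_fsum_def
      fsum_scale[of _ 0 0, unfolded lk_scale_zero_left, simplified])

lemma fsum_kernel_condition:
  assumes "l = r \<or> l = - (r ^ 3)"
  shows "r ^ 4 / l\<^sup>2 + m * r\<^sup>2 / l - 1 = 0"
  using assms r by (auto simp: bmw_m_def field_simps eval_nat_numeral)

lemma fsum_kernel_proper:
  assumes "n \<ge> 3"
  shows "lk_w 1 2 \<notin> {v \<in> lk_carrier n l r. \<forall>i\<in>{1..n}. fsum i v = 0}"
  using assms r by (auto simp: fsum_w intro!: bexI[of _ 1])

lemma reducible_fsum:
  assumes "l = r \<or> l = - (r ^ 3)" "n \<ge> 4"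
  shows "\<not> lk_irreducible n l r"
proof (rule reducibleI[OF nu_stable_fsum_kernel[OF fsum_kernel_condition[OF assms(1)]]])
  \<comment> \<open>This vector lies in every kernel whatever \<open>l\<close> is: within each row
    and each column the two entries cancel in the weighted sum. It needs four indices.\<close>
  let ?y = "lk_w 1 3 - lk_scale (1 / r) (lk_w 1 4) - lk_scale (1 / r) (lk_w 2 3) + lk_scale (1 / r\<^sup>2) (lk_w 2 4)"
  have "?y \<in> lk_carrier n l r"
    using assms(2) by (intro lk_carrier_add lk_carrier_diff lk_carrier_scale lk_carrier_w ground_intros) auto
  moreover have "fsum i ?y = 0" for i
    using assms(2) r by (auto simp: fsum_linear fsum_w eval_nat_numeral)
  ultimately show "?y \<in> {v \<in> lk_carrier n l r. \<forall>i\<in>{1..n}. fsum i v = 0}" by blast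
  have "Poly_Mapping.lookup ?y (1, 3) = 1" by (simp add: lookup_add lookup_minus lookup_lk_w)
  then show "?y \<noteq> 0" by (metis lookup_zero zero_neq_one)
  show "lk_w 1 2 \<in> lk_carrier n l r" using assms(2) by (intro lk_carrier_w) auto
  show "lk_w 1 2 \<notin> {v \<in> lk_carrier n l r. \<forall>i\<in>{1..n}. fsum i v = 0}"
    using assms(2) by (intro fsum_kernel_proper) simp
qed

text \<open>For \<open>n = 3\<close> the equations \<open>f_1 = f_3 = 0\<close> give
  \<open>a_13 = -r a_23\<close> and \<open>a_12 = r^2 a_23\<close>, and then
  \<open>f_2 = r^3 (1 + r^3 / l) a_23\<close>. The common kernel is therefore nonzero only for
  \<open>l = -r^3\<close>, and it is spanned by \<open>?y\<close>.\<close>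

lemma reducible_fsum_3:
  assumes "l = - (r ^ 3)" "n = 3"
  shows "\<not> lk_irreducible n l r"
proof (rule reducibleI[OF nu_stable_fsum_kernel[OF fsum_kernel_condition[OF disjI2[OF assms(1)]]]])
  let ?y = "lk_scale (r\<^sup>2) (lk_w 1 2) - lk_scale r (lk_w 1 3) + lk_w 2 3"
  have "?y \<in> lk_carrier n l r"
    using assms(2) by (intro lk_carrier_add lk_carrier_diff lk_carrier_scale lk_carrier_w ground_intros) auto
  moreover have "fsum i ?y = 0" for i
  proof -
    have "3 \<le> n" "2 \<le> n" "r ^ 3 / l = - 1" using assms r by simp_all
    then show ?thesis by (simp add: fsum_linear fsum_w power2_eq_square power3_eq_cube)
  qed
  ultimately show "?y \<in> {v \<in> lk_carrier n l r. \<forall>i\<in>{1..n}. fsum i v = 0}" by blast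
  have "Poly_Mapping.lookup ?y (2, 3) = 1" by (simp add: lookup_add lookup_minus lookup_lk_w)
  then show "?y \<noteq> 0" by (metis lookup_zero zero_neq_one)
  show "lk_w 1 2 \<in> lk_carrier n l r" using assms(2) by (intro lk_carrier_w) auto
  show "lk_w 1 2 \<notin> {v \<in> lk_carrier n l r. \<forall>i\<in>{1..n}. fsum i v = 0}"
    using assms(2) by (intro fsum_kernel_proper) simp
qed

section \<open>The one-dimensional stable subspace\<close>

lemma power_double: "r ^ (2 * j) = r ^ j * r ^ j"
  by (simp add: mult_2 power_add)

text \<open>The factor \<open>m = 1/r - r\<close> makes the sum telescope:
  \<open>m r^{2j} = r^{2j-1} - r^{2j+1}\<close>.\<close>

lemma geometric_sum:
  assumes "a \<le> b"
  shows "m * (\<Sum>j\<in>{a<..b}. r ^ (2 * j)) = r ^ (2 * a + 1) - r ^ (2 * b + 1)"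
  using assms
proof (induction b rule: dec_induct)
  case (step b)
  have "{a<..Suc b} = insert (Suc b) {a<..b}" using step(1) by auto
  moreover have "m * r ^ (2 * Suc b) = r ^ (2 * b + 1) - r ^ (2 * Suc b + 1)"
    using r by (simp add: bmw_m_def algebra_simps)
  ultimately show ?case using step.IH by (simp add: distrib_left)
qed simp

lemma reducible_one_dim:
  assumes "l = 1 / r ^ (2 * n - 3)" "n \<ge> 3"
  shows "\<not> lk_irreducible n l r"
proof (rule reducibleI)
  let ?W = "{v \<in> lk_carrier n l r. \<forall>k. 1 \<le> k \<longrightarrow> k < n \<longrightarrow> nu l r k v = lk_scale r v}"
  show "nu_stable ?W"
    unfolding nu_stable_def
    by (auto simp: lk_carrier_zero lk_carrier_add lk_carrier_scale ground_r nu_zero nu_add nu_scale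
        lk_scale_zero_right lk_scale_add_right lk_scale_scale mult.commute)
  define u where "u = lk_of (\<lambda>i j. r ^ (i + j))"
  have u: "u \<in> lk_carrier n l r" unfolding u_def by (intro lk_carrier_lk_of ground_intros)
  have lookup_u: "Poly_Mapping.lookup u (i, j) = r ^ (i + j)" if "1 \<le> i" "i < j" "j \<le> n" for i j
    using that by (simp add: u_def lookup_lk_of)
  have "nu l r k u = lk_scale r u" if k: "1 \<le> k" "k < n" for k
  proof (rule lk_carrier_eqI)
    \<comment> \<open>For \<open>a_{ij} = r^{i+j}\<close> both sums in \<open>f_i\<close> are
      \<open>r^i\<close> times geometric sums of \<open>r^{2j}\<close>.\<close>
    have fsum_u: "m * fsum i u = r ^ i * (r ^ (2 * i + 1) - r ^ (2 * n + 1) + r ^ 3 / l * (r - r ^ (2 * i - 1)))"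
      if "1 \<le> i" "i \<le> n" for i
    proof -
      have "fsum i u = (\<Sum>j\<in>{i<..n}. r ^ j * r ^ (i + j)) + r ^ 3 / l * (\<Sum>j\<in>{0<..i - 1}. r ^ j * r ^ (j + i))"
        unfolding fsum_def using that
        by (intro arg_cong2[where f = "(+)"] arg_cong2[where f = "(*)"] sum.cong refl) (auto simp: lookup_u)
      also have "\<dots> = r ^ i * ((\<Sum>j\<in>{i<..n}. r ^ (2 * j)) + r ^ 3 / l * (\<Sum>j\<in>{0<..i - 1}. r ^ (2 * j)))"
        unfolding power_double by (simp add: distrib_left sum_distrib_left power_add mult_ac)
      finally have "m * fsum i u = r ^ i * (m * (\<Sum>j\<in>{i<..n}. r ^ (2 * j))
          + r ^ 3 / l * (m * (\<Sum>j\<in>{0<..i - 1}. r ^ (2 * j))))"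
        by (simp add: distrib_left mult_ac)
      moreover have "2 * (i - 1) + 1 = 2 * i - 1" using that by simp
      ultimately show ?thesis using that
        by (simp only: geometric_sum[of 0 "i - 1"] geometric_sum[of i n] le0) simp
    qed
    \<comment> \<open>The value of \<open>l\<close> enters here: the upper end
      \<open>r^{2n+1}\<close> of the first sum becomes \<open>r^4 / l\<close> and cancels the lower
      end of the second.\<close>
    have "r ^ (2 * n + 1) = r ^ (2 * n - 3) * r ^ 4"
      using assms(2) by (simp flip: power_add)
    then have "r ^ (2 * n + 1) = r ^ 4 / l" using assms(1) by simp
    then have "m / r ^ (k + 2) * fsum (Suc k) u = 1 / r ^ (k + 2) * (r ^ Suc k *
        (r ^ (2 * k + 3) - r ^ 4 / l + r ^ 3 / l * (r - r ^ (2 * k + 1))))"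
      using k fsum_u[of "Suc k"] by (simp add: numeral_eq_Suc)
    also have "\<dots> = r ^ (2 * k + 2) - r ^ (2 * k + 3) / l"
      using r l by (simp add: field_simps eval_nat_numeral)
    finally have *: "m / r ^ (k + 2) * fsum (Suc k) u = r ^ (2 * k + 2) - r ^ (2 * k + 3) / l" .
    fix i j assume ij: "1 \<le> i" "i < j" "j \<le> n"
    have k': "i < k \<Longrightarrow> i < Suc k" "Suc k \<le> n" "k \<le> n" "1 \<le> Suc k" "Suc k < j \<Longrightarrow> k < j" using k(2) by linarith+
    have rs: "p - r * (m * p) = r * (r * p)" for p
      using r by (simp add: bmw_m_def algebra_simps)
    from ij(2) show "Poly_Mapping.lookup (nu l r k u) (i, j) = Poly_Mapping.lookup (lk_scale r u) (i, j)"
    proof (cases rule: pair_order_cases[where k = k])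
      case A: 4
      have e: "2 * k + 3 = 2 + (k + Suc k)" "2 * k + 2 = 1 + (k + Suc k)" by simp_all
      have "r\<^sup>2 / l * r ^ (k + Suc k) + (r ^ (2 * k + 2) - r ^ (2 * k + 3) / l) = r * r ^ (k + Suc k)"
        unfolding e power_add[of r 2] power_add[of r 1] by (simp only: power_one_right) simp
      moreover have "Poly_Mapping.lookup (nu l r k u) (k, Suc k) =
          r\<^sup>2 / l * r ^ (k + Suc k) + (r ^ (2 * k + 2) - r ^ (2 * k + 3) / l)"
        unfolding lookup_nu_simps(4)[OF k u] * using k lookup_u[of k "Suc k"] by simp
      ultimately show ?thesis using k lookup_u[of k "Suc k"] by (simp only: A lookup_lk_scale)
    next
      case A: 1
      show ?thesis
        by (simp only: A lookup_nu_simps[OF k u] lookup_lk_scale lookup_u ij k k' lessI; simp add: r rs power_add mult_ac)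
    next
      case A: 2
      show ?thesis
        by (simp only: A lookup_nu_simps[OF k u] lookup_lk_scale lookup_u ij k k' lessI; simp add: r rs power_add mult_ac)
    next
      case A: 3
      show ?thesis
        by (simp only: A lookup_nu_simps[OF k u] lookup_lk_scale lookup_u ij k k' lessI; simp add: r rs power_add mult_ac)
    next
      case A: 5
      show ?thesis
        by (simp only: A lookup_nu_simps[OF k u] lookup_lk_scale lookup_u ij k k' lessI; simp add: r rs power_add mult_ac)
    next
      case A: 6
      show ?thesis
        by (simp only: A lookup_nu_simps[OF k u] lookup_lk_scale lookup_u ij k k' lessI; simp add: r rs power_add mult_ac)
    next
      case A: 7
      show ?thesis
        by (simp only: A lookup_nu_simps[OF k u] lookup_lk_scale lookup_u ij k k' lessI; simp add: r rs power_add mult_ac)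
    next
      case A: 8
      show ?thesis
        by (simp only: A lookup_nu_simps[OF k u] lookup_lk_scale lookup_u ij k k' lessI; simp add: r rs power_add mult_ac)
    qed
  qed (use k u in \<open>auto intro: lk_carrier_nu lk_carrier_scale ground_r\<close>)
  then show "u \<in> ?W" using u by simp
  show "u \<noteq> 0" using lookup_u[of 1 2] assms(2) r by auto
  show "lk_w 1 2 \<in> lk_carrier n l r" using assms(2) by (intro lk_carrier_w) auto
  have "nu l r 2 (lk_w 1 2) = lk_w 1 3"
    using nu_basis_simps(4)[of 1 2] by (simp add: nu_w)
  then have "Poly_Mapping.lookup (nu l r 2 (lk_w 1 2)) (1, 3) \<noteq> Poly_Mapping.lookup (lk_scale r (lk_w 1 2)) (1, 3)"
    by (simp add: lookup_lk_w)
  then have "nu l r 2 (lk_w 1 2) \<noteq> lk_scale r (lk_w 1 2)" by metis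
  moreover have "1 \<le> (2::nat)" "2 < n" using assms(2) by simp_all
  ultimately show "lk_w 1 2 \<notin> ?W" by blast
qed

text \<open>On the parameters $t$, the generator $\nu_k$ acts by a Burau matrix:
  $t_k \mapsto t_{k+1}$, $t_{k+1} \mapsto t_k - m t_{k+1}$, and $t_i \mapsto r t_i$ otherwise.\<close>

definition burau_coord :: "(nat \<Rightarrow> complex) \<Rightarrow> lk_vec \<Rightarrow> bool" where
  "burau_coord t v \<longleftrightarrow> (\<forall>i. t i \<in> ground_set l r) \<and> (\<Sum>i\<in>{1..n}. r ^ i * t i) = 0 \<and>
     (\<forall>i j. 1 \<le> i \<longrightarrow> i < j \<longrightarrow> j \<le> n \<longrightarrow>
       Poly_Mapping.lookup v (i, j) = r ^ i * t j + l / r ^ 3 * (r ^ j * t i))"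

definition burau_space :: "lk_vec set" where
  "burau_space = {v \<in> lk_carrier n l r. \<exists>t. burau_coord t v}"

lemma burau_coordD:
  assumes "burau_coord t v"
  shows "t i \<in> ground_set l r" "(\<Sum>i\<in>{1..n}. r ^ i * t i) = 0"
    and "\<lbrakk>1 \<le> i; i < j; j \<le> n\<rbrakk> \<Longrightarrow> Poly_Mapping.lookup v (i, j) = r ^ i * t j + l / r ^ 3 * (r ^ j * t i)"
  using assms unfolding burau_coord_def by blast+

lemma burau_coordI:
  assumes "\<And>i. t i \<in> ground_set l r" "(\<Sum>i\<in>{1..n}. r ^ i * t i) = 0"
    and "\<And>i j. \<lbrakk>1 \<le> i; i < j; j \<le> n\<rbrakk> \<Longrightarrow>
      Poly_Mapping.lookup v (i, j) = r ^ i * t j + l / r ^ 3 * (r ^ j * t i)"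
  shows "burau_coord t v"
  using assms unfolding burau_coord_def by blast

text \<open>On these vectors \<open>f_i\<close> is local: it depends on \<open>t_i\<close> alone.
  The constant \<open>l / r^3\<close> is inverse to the weight \<open>r^3 / l\<close>, so the terms
  with \<open>t_j\<close>, \<open>j\<close> different from \<open>i\<close>, carry equal weights on
  both sides of \<open>i\<close> and collapse by \<open>sum r^j t_j = 0\<close>. The terms with
  \<open>t_i\<close> are geometric sums, whose outer ends cancel exactly by the condition on
  \<open>l^2\<close>.\<close>

lemma burau_fsum:
  assumes ll: "l\<^sup>2 * r ^ (2 * n) = r ^ 6"
    and tv: "burau_coord t v"
    and i: "1 \<le> i" "i \<le> n"
  shows "m * fsum i v = t i * r ^ (2 * i) * (l / r\<^sup>2 - m - r\<^sup>2 / l)"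
proof -
  note t = burau_coordD(2)[OF tv] and v = burau_coordD(3)[OF tv]
  define c where "c = l / r ^ 3"
  have c: "r ^ 3 / l * c = 1" using l r by (simp add: c_def)
  have "fsum i v = (\<Sum>j\<in>{i<..n}. r ^ j * (r ^ i * t j + c * (r ^ j * t i)))
      + r ^ 3 / l * (\<Sum>j\<in>{0<..i - 1}. r ^ j * (r ^ j * t i + c * (r ^ i * t j)))"
    unfolding fsum_def c_def using i
    by (intro arg_cong2[where f = "(+)"] arg_cong2[where f = "(*)"] sum.cong refl) (auto simp: v)
  also have "\<dots> = r ^ i * ((\<Sum>j\<in>{i<..n}. r ^ j * t j) + (r ^ 3 / l * c) * (\<Sum>j\<in>{0<..i - 1}. r ^ j * t j))
      + t i * (c * (\<Sum>j\<in>{i<..n}. r ^ (2 * j)) + r ^ 3 / l * (\<Sum>j\<in>{0<..i - 1}. r ^ (2 * j)))"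
    unfolding power_double by (simp add: distrib_left sum.distrib sum_distrib_left power_add mult_ac)
  also have "(\<Sum>j\<in>{i<..n}. r ^ j * t j) + (r ^ 3 / l * c) * (\<Sum>j\<in>{0<..i - 1}. r ^ j * t j) = - (r ^ i * t i)"
  proof -
    have "{1..n} = {0<..i - 1} \<union> {i} \<union> {i<..n}" using i by auto
    then have "(\<Sum>j\<in>{1..n}. r ^ j * t j) =
        (\<Sum>j\<in>{0<..i - 1}. r ^ j * t j) + r ^ i * t i + (\<Sum>j\<in>{i<..n}. r ^ j * t j)"
      using i by (subst \<open>{1..n} = _\<close>, subst sum.union_disjoint) (auto simp: sum.union_disjoint)
    then show ?thesis using t unfolding c by (simp add: algebra_simps eq_neg_iff_add_eq_0)
  qed
  finally have e: "fsum i v = r ^ i * (- (r ^ i * t i))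
      + t i * (c * (\<Sum>j\<in>{i<..n}. r ^ (2 * j)) + r ^ 3 / l * (\<Sum>j\<in>{0<..i - 1}. r ^ (2 * j)))" .
  have "m * fsum i v = - (m * r ^ (2 * i) * t i)
      + t i * (c * (m * (\<Sum>j\<in>{i<..n}. r ^ (2 * j))) + r ^ 3 / l * (m * (\<Sum>j\<in>{0<..i - 1}. r ^ (2 * j))))"
    unfolding e power_double[of i] by (simp add: algebra_simps)
  also have "m * (\<Sum>j\<in>{i<..n}. r ^ (2 * j)) = r ^ (2 * i) * r - r ^ (2 * n) * r"
    using i by (simp add: geometric_sum)
  also have "m * (\<Sum>j\<in>{0<..i - 1}. r ^ (2 * j)) = r - r ^ (2 * i) / r"
  proof -
    have "2 * i = Suc (2 * (i - 1) + 1)" using i by simp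
    then have "r ^ (2 * i) = r * r ^ (2 * (i - 1) + 1)" by (metis power_Suc)
    then show ?thesis using r geometric_sum[of 0 "i - 1"] by simp
  qed
  also have "r ^ (2 * n) = r ^ 6 / l\<^sup>2" using ll l by (simp add: field_simps)
  also have "c * (r ^ (2 * i) * r - r ^ 6 / l\<^sup>2 * r) = r ^ (2 * i) * (l / r\<^sup>2) - r ^ 4 / l"
    using r l by (simp add: c_def right_diff_distrib eval_nat_numeral)
  also have "r ^ 3 / l * (r - r ^ (2 * i) / r) = r ^ 4 / l - r ^ (2 * i) * (r\<^sup>2 / l)"
    using r l by (simp add: right_diff_distrib eval_nat_numeral mult_ac)
  finally show ?thesis by (simp add: algebra_simps)
qed

lemma nu_stable_burau:
  assumes ll: "l\<^sup>2 * r ^ (2 * n) = r ^ 6"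
  shows "nu_stable burau_space"
proof -
  define c where "c = l / r ^ 3"
  have add: "u + v \<in> burau_space" if uv: "u \<in> burau_space" "v \<in> burau_space" for u v
  proof -
    obtain s t where s: "burau_coord s u" and t: "burau_coord t v" using uv unfolding burau_space_def by blast
    have "burau_coord (\<lambda>i. s i + t i) (u + v)"
      using burau_coordD(2)[OF s] burau_coordD(2)[OF t]
      by (intro burau_coordI)
         (simp_all add: burau_coordD(1,3)[OF s] burau_coordD(1,3)[OF t] ground_add lookup_add distrib_left sum.distrib)
    then show ?thesis using uv by (auto simp: burau_space_def lk_carrier_add)
  qed
  have scale: "lk_scale d v \<in> burau_space" if vd: "v \<in> burau_space" "d \<in> ground_set l r" for d v
  proof -
    obtain t where t: "burau_coord t v" using vd(1) unfolding burau_space_def by blast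
    have "(\<Sum>i\<in>{1..n}. r ^ i * (d * t i)) = d * (\<Sum>i\<in>{1..n}. r ^ i * t i)"
      by (simp add: sum_distrib_left mult_ac)
    then have "(\<Sum>i\<in>{1..n}. r ^ i * (d * t i)) = 0"
      unfolding burau_coordD(2)[OF t] by (simp only: mult_zero_right)
    then have "burau_coord (\<lambda>i. d * t i) (lk_scale d v)"
      using vd(2) by (intro burau_coordI)
         (simp_all only: burau_coordD[OF t] ground_mult lookup_lk_scale distrib_left mult_ac mult_zero_right)
    then show ?thesis using vd by (auto simp: burau_space_def lk_carrier_scale)
  qed
  have "burau_coord (\<lambda>_. 0) 0" by (rule burau_coordI) (simp_all add: ground_zero)
  then have zero: "0 \<in> burau_space"
    using lk_carrier_zero by (auto simp: burau_space_def)
  have nu: "nu l r k v \<in> burau_space" if k: "1 \<le> k" "k < n" and vW: "v \<in> burau_space" for k v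
  proof -
    obtain t where tv: "burau_coord t v" and v: "v \<in> lk_carrier n l r"
      using vW unfolding burau_space_def by blast
    note t = burau_coordD(1,2)[OF tv] and a = burau_coordD(3)[OF tv, folded c_def]
    define t' where "t' = (\<lambda>i. if i = k then t (Suc k) else if i = Suc k then t k - m * t (Suc k) else r * t i)"
    have t'_simps: "t' k = t (Suc k)" "t' (Suc k) = t k - m * t (Suc k)"
      "i < k \<Longrightarrow> t' i = r * t i" "Suc k < i \<Longrightarrow> t' i = r * t i" for i
      by (simp_all add: t'_def)
    have "t' i \<in> ground_set l r" for i
      using t(1) unfolding t'_def by (auto intro!: ground_intros)
    \<comment> \<open>The linear form \<open>sum r^i t_i\<close> is scaled by \<open>r\<close>: on
      the indices \<open>k\<close> and \<open>k+1\<close> this is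
      \<open>1 - m r = r^2\<close>.\<close>
    moreover have "(\<Sum>i\<in>{1..n}. r ^ i * t' i) = 0"
    proof -
      have split: "{1..n} = insert k (insert (Suc k) ({1..n} - {k, Suc k}))" using k by auto
      have "(\<Sum>i\<in>{1..n}. r ^ i * f i) = r ^ k * f k + (r ^ Suc k * f (Suc k) + (\<Sum>i\<in>{1..n} - {k, Suc k}. r ^ i * f i))"
        for f :: "nat \<Rightarrow> complex"
        by (subst split) (simp del: power_Suc)
      note S = this
      have "(\<Sum>i\<in>{1..n} - {k, Suc k}. r ^ i * t' i) = r * (\<Sum>i\<in>{1..n} - {k, Suc k}. r ^ i * t i)"
        unfolding sum_distrib_left by (rule sum.cong) (auto simp: t'_def)
      moreover have "r ^ k * t' k + r ^ Suc k * t' (Suc k) = r * (r ^ k * t k + r ^ Suc k * t (Suc k))"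
        using r by (simp add: t'_simps bmw_m_def algebra_simps)
      ultimately have "(\<Sum>i\<in>{1..n}. r ^ i * t' i) = r * (\<Sum>i\<in>{1..n}. r ^ i * t i)"
        unfolding S[of t'] S[of t] by (simp add: distrib_left)
      then show ?thesis using t(2) by simp
    qed
    moreover have "Poly_Mapping.lookup (nu l r k v) (i, j) = r ^ i * t' j + c * (r ^ j * t' i)"
      if ij: "1 \<le> i" "i < j" "j \<le> n" for i j
    proof -
      have k': "i < k \<Longrightarrow> i < Suc k" "Suc k \<le> n" "k \<le> n" "1 \<le> Suc k" "Suc k < j \<Longrightarrow> k < j" using k(2) by linarith+
      have rs: "r ^ p - m * (r * r ^ p) = r * (r * r ^ p)" for p
        using r by (simp add: bmw_m_def algebra_simps)
      from ij(2) show ?thesis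
      proof (cases rule: pair_order_cases[where k = k])
        case A: 4
        \<comment> \<open>The only nonlocal entry: \<open>burau_fsum\<close> turns
          \<open>f_{k+1}\<close> into a multiple of \<open>t_{k+1}\<close>, and the claim becomes an
          identity in \<open>t_k\<close> and \<open>t_{k+1}\<close>.\<close>
        have "m * fsum (Suc k) v = t (Suc k) * r ^ (2 * Suc k) * (l / r\<^sup>2 - m - r\<^sup>2 / l)"
          using k by (intro burau_fsum[OF ll tv]) simp_all
        then have "m / r ^ (k + 2) * fsum (Suc k) v = t (Suc k) * r ^ k * (l / r\<^sup>2 - m - r\<^sup>2 / l)"
        proof -
          have div: "m / q * f = t0 * p * z" if "m * f = t0 * (q * p) * z" "q \<noteq> 0" for q f t0 p z :: complex
            using that by (simp add: field_simps)
          have "2 * Suc k = (k + 2) + k" by simp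
          with \<open>m * fsum (Suc k) v = _\<close> show ?thesis
            using r by (intro div) (simp_all only: power_add[of r "k + 2" k] power_not_zero not_False_eq_True)
        qed
        moreover have "r\<^sup>2 / l * (r ^ k * t (Suc k) + c * (r ^ Suc k * t k)) + t (Suc k) * r ^ k * (l / r\<^sup>2 - m - r\<^sup>2 / l)
          = r ^ k * (t k - m * t (Suc k)) + c * (r ^ Suc k * t (Suc k))"
        proof -
          have cr: "r\<^sup>2 / l * c * r = 1" "l / r\<^sup>2 = c * r" using r l by (simp_all add: c_def eval_nat_numeral)
          have "y * (p * t1 + c * (r * p * t0)) + t1 * p * (c * r - m - y) = p * (t0 - m * t1) + c * (r * p * t1)"
            if "y * c * r = 1" for y p t0 t1
          proof -
            have "y * (c * (r * p * t0)) = (y * c * r) * (p * t0)" by (simp only: mult_ac)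
            then have "y * (c * (r * p * t0)) = p * t0" using that by simp
            then show ?thesis by (simp add: algebra_simps)
          qed
          from this[OF cr(1), of "r ^ k" "t (Suc k)" "t k"] show ?thesis by (simp only: cr(2) power_Suc)
        qed
        ultimately show ?thesis using k ij
          by (simp only: A lookup_nu_simps(4)[OF k v] t'_simps a lessI k')
      next
        case A: 1
        then have "i < k" using ij by linarith
        with A show ?thesis by (simp only: lookup_nu_simps[OF k v] t'_simps a ij k'; simp add: algebra_simps)
      next
        case A: 2
        show ?thesis by (simp only: A lookup_nu_simps[OF k v] t'_simps a ij k'; simp add: algebra_simps)
      next
        case A: 3
        then have "Suc k < j" using ij by linarith
        then show ?thesis by (simp only: A lookup_nu_simps[OF k v] t'_simps a ij k'; simp add: algebra_simps)
      next
        case A: 5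
        show ?thesis by (simp only: A lookup_nu_simps[OF k v] t'_simps a ij k'; simp add: algebra_simps)
      next
        case A: 6
        have "Poly_Mapping.lookup (nu l r k v) (Suc k, j) = (r ^ k - m * (r * r ^ k)) * t j + c * (r ^ j * (t k - m * t (Suc k)))"
          by (simp only: A lookup_nu_simps[OF k v] a ij k k' ; simp add: algebra_simps)
        then show ?thesis by (simp only: A t'_simps rs; simp add: algebra_simps)
      next
        case A: 7
        show ?thesis by (simp only: A lookup_nu_simps[OF k v] t'_simps a ij k k'; simp add: algebra_simps)
      next
        case A: 8
        have "Poly_Mapping.lookup (nu l r k v) (i, Suc k) = r ^ i * (t k - m * t (Suc k)) + c * ((r ^ k - m * (r * r ^ k)) * t i)"
          by (simp only: A lookup_nu_simps[OF k v] a ij k k' ; simp add: algebra_simps)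
        then show ?thesis by (simp only: A t'_simps rs; simp add: algebra_simps)
      qed
    qed
    ultimately have "burau_coord t' (nu l r k v)"
      unfolding c_def by (intro burau_coordI)
    then show ?thesis
      unfolding burau_space_def using lk_carrier_nu[OF v k] by blast
  qed
  show ?thesis
    unfolding nu_stable_def using add scale zero nu by (auto simp: burau_space_def)
qed

lemma reducible_burau:
  assumes ll: "l\<^sup>2 * r ^ (2 * n) = r ^ 6" and n: "n \<ge> 3"
  shows "\<not> lk_irreducible n l r"
proof (rule reducibleI[OF nu_stable_burau[OF ll]])
  \<comment> \<open>The parameters \<open>(r, -1, 0, ..., 0)\<close> satisfy
    \<open>sum r^i t_i = r r - r^2 = 0\<close>.\<close>
  define t where "t = (\<lambda>i::nat. if i = 1 then r else if i = 2 then - 1 else 0)"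
  define u where "u = lk_of (\<lambda>i j. r ^ i * t j + l / r ^ 3 * (r ^ j * t i))"
  have t: "t i \<in> ground_set l r" for i by (auto simp: t_def intro!: ground_intros)
  have "{1..n} = {1, 2} \<union> {3..n}" using n by auto
  then have "(\<Sum>i\<in>{1..n}. r ^ i * t i) = (\<Sum>i\<in>{1, 2}. r ^ i * t i) + (\<Sum>i\<in>{3..n}. r ^ i * t i)"
    by (simp only:) (rule sum.union_disjoint, auto)
  also have "(\<Sum>i\<in>{3..n}. r ^ i * t i) = 0" by (rule sum.neutral) (auto simp: t_def)
  finally have "(\<Sum>i\<in>{1..n}. r ^ i * t i) = 0" by (simp add: t_def power2_eq_square)
  moreover have "u \<in> lk_carrier n l r"
    unfolding u_def by (intro lk_carrier_lk_of ground_intros t)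
  ultimately show "u \<in> burau_space"
    unfolding burau_space_def burau_coord_def using t by (auto simp: u_def lookup_lk_of)
  have "Poly_Mapping.lookup u (1, 3) = l * r"
    using n r by (simp add: u_def lookup_lk_of t_def)
  then show "u \<noteq> 0" using l r by auto
  show w: "lk_w 1 3 \<in> lk_carrier n l r" using n by (intro lk_carrier_w) auto
  \<comment> \<open>Since \<open>f_1 (w_13)\<close> is nonzero, both \<open>K\<close> and
    \<open>s_1\<close> are nonzero; then \<open>f_2 (w_13) = 0\<close> gives \<open>s_2 = 0\<close>.
    The entry at \<open>(1, 2)\<close> would be a nonzero multiple of \<open>s_1\<close>, but it is
    0.\<close>
  show "lk_w 1 3 \<notin> burau_space"
  proof
    assume "lk_w 1 3 \<in> burau_space"
    then obtain s where s: "burau_coord s (lk_w 1 3)"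
      unfolding burau_space_def by blast
    define K where "K = l / r\<^sup>2 - m - r\<^sup>2 / l"
    have f: "m * fsum i (lk_w 1 3) = s i * r ^ (2 * i) * K" if "1 \<le> i" "i \<le> n" for i
      unfolding K_def using that by (intro burau_fsum[OF ll s])
    have f1: "m * r ^ 3 = s 1 * r ^ 2 * K" using f[of 1] n by (simp add: fsum_w)
    then have "K \<noteq> 0" "s 1 \<noteq> 0" using m_nz r by auto
    moreover have "s 2 * r ^ 4 * K = 0" using f[of 2] n by (simp add: fsum_w)
    ultimately have "s 2 = 0" using r by simp
    then have "l / r ^ 3 * (r ^ 2 * s 1) = 0" using burau_coordD(3)[OF s, of 1 2] n by (simp add: lookup_lk_w)
    then show False using \<open>s 1 \<noteq> 0\<close> l r by simp
  qed
qed

section \<open>The irreducible cases\<close>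

lemma w_step_up:
  assumes W: "nu_stable W" and k: "1 \<le> k" "Suc k < n" and w: "lk_w k (Suc k) \<in> W"
  shows "lk_w (Suc k) (Suc (Suc k)) \<in> W"
proof -
  have "nu l r (Suc k) (lk_w k (Suc k)) = lk_w k (Suc (Suc k))"
    using nu_basis_simps(4)[of k "Suc k"] by (simp add: nu_w)
  then have "lk_w k (Suc (Suc k)) \<in> W" using nu_stableD(5)[OF W _ k(2) w] by simp
  moreover have "nu l r k (lk_w k (Suc (Suc k))) = lk_w (Suc k) (Suc (Suc k))"
    using nu_basis_simps(2)[of k "Suc (Suc k)"] by (simp add: nu_w)
  ultimately show ?thesis using nu_stableD(5)[OF W k(1)] k(2) by (metis Suc_lessD)
qed

lemma w_step_down:
  assumes W: "nu_stable W" and k: "1 \<le> k" "Suc k < n" and w: "lk_w (Suc k) (Suc (Suc k)) \<in> W"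
  shows "lk_w k (Suc k) \<in> W"
proof -
  have kn: "k < n" using k by simp
  \<comment> \<open>Adding \<open>m\<close> to \<open>nu_k\<close> removes the term
    \<open>-m w_{k+1,k+2}\<close>. A second \<open>nu_k\<close> sends \<open>w_{k,k+2}\<close> back
    to \<open>w_{k+1,k+2}\<close>, and subtracting that leaves
    \<open>(m / l) w_{k,k+1}\<close>.\<close>
  let ?z = "nu l r k (lk_w (Suc k) (Suc (Suc k))) + lk_scale m (lk_w (Suc k) (Suc (Suc k)))"
  have "nu l r k (lk_w (Suc k) (Suc (Suc k))) =
      lk_w k (Suc (Suc k)) + lk_scale m (lk_w k (Suc k)) - lk_scale m (lk_w (Suc k) (Suc (Suc k)))"
    using nu_basis_simps(3)[of k 0] by (simp add: nu_w)
  then have z: "?z = lk_w k (Suc (Suc k)) + lk_scale m (lk_w k (Suc k))" by simp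
  have "nu l r k ?z = lk_w (Suc k) (Suc (Suc k)) + lk_scale (m * inverse l) (lk_w k (Suc k))"
    unfolding z using nu_basis_simps(2)[of k "Suc (Suc k)"]
    by (simp add: nu_add nu_scale nu_w nu_basis_simps(1) lk_scale_scale)
  then have e: "lk_scale (l / m) (nu l r k ?z - lk_w (Suc k) (Suc (Suc k))) = lk_w k (Suc k)"
    using l m_nz by (simp add: lk_scale_scale lk_scale_one field_simps)
  have "lk_scale (l / m) (nu l r k ?z - lk_w (Suc k) (Suc (Suc k))) \<in> W"
    by (intro nu_stableD[OF W] w k kn ground_intros)
  then show ?thesis by (simp only: e)
qed

lemma nu_stable_eq_carrier:
  assumes W: "nu_stable W" and k: "1 \<le> k" "k < n" and w: "lk_w k (Suc k) \<in> W"
  shows "W = lk_carrier n l r"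
proof -
  have down: "k \<ge> 1 \<Longrightarrow> k < n \<Longrightarrow> lk_w k (Suc k) \<in> W \<Longrightarrow> lk_w 1 2 \<in> W" for k
  proof (induction k rule: nat_induct_at_least)
    case base then show ?case by (simp add: numeral_2_eq_2)
  next
    case (Suc k) then show ?case using w_step_down[OF W, of k] by simp
  qed
  have w12: "lk_w 1 2 \<in> W" by (rule down[OF k w])
  have diag: "i \<ge> 1 \<Longrightarrow> i < n \<Longrightarrow> lk_w i (Suc i) \<in> W" for i
  proof (induction i rule: nat_induct_at_least)
    case base then show ?case using w12 by (simp add: numeral_2_eq_2)
  next
    case (Suc i) then show ?case using w_step_up[OF W, of i] by simp
  qed
  have all: "lk_w i j \<in> W" if i: "1 \<le> i" and "i < j" "j \<le> n" for i j
    using that(2,3)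
  proof (induction j)
    case (Suc j)
    show ?case
    proof (cases "i = j")
      case True then show ?thesis using diag i Suc.prems by simp
    next
      case False
      then have ij: "i < j" using Suc.prems by simp
      have "nu l r j (lk_w i j) = lk_w i (Suc j)" by (simp add: nu_w nu_basis_simps(4)[OF ij])
      moreover have "1 \<le> j" "j < n" using i ij Suc.prems by simp_all
      moreover have "lk_w i j \<in> W" using Suc ij by simp
      ultimately show ?thesis using nu_stableD(5)[OF W] by metis
    qed
  qed simp
  have "v \<in> W" if v: "v \<in> lk_carrier n l r" for v
  proof -
    have keys: "Poly_Mapping.keys v \<subseteq> lk_index n" and "\<And>p. Poly_Mapping.lookup v p \<in> ground_set l r"
      using v unfolding lk_carrier_iff by blast+
    then have "(\<Sum>p\<in>lk_index n. lk_scale (Poly_Mapping.lookup v p) (lk_w (fst p) (snd p))) \<in> W"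
      by (intro nu_stable_sum[OF W] nu_stableD(4)[OF W] all) (auto simp: lk_index_def)
    then show ?thesis using lk_expand[OF finite_lk_index keys] by simp
  qed
  then show ?thesis using nu_stableD(1)[OF W] by blast
qed

lemma eps_eq_0_of_proper:
  assumes W: "nu_stable W" "W \<noteq> lk_carrier n l r" and k: "1 \<le> k" "k < n" and v: "v \<in> W"
  shows "eps k v = 0"
proof (rule ccontr)
  assume nz: "eps k v \<noteq> 0"
  have vC: "v \<in> lk_carrier n l r" by (rule nu_stableD(1)[OF W(1) v])
  \<comment> \<open>Dividing by this scalar stays inside \<open>W\<close> only because it lies in
    F.\<close>
  have F: "m * eps k v \<in> ground_set l r"
    using vC unfolding eps_def fsum_def lk_carrier_iff by (auto intro!: ground_intros)
  have "lk_scale (m * eps k v) (lk_w k (Suc k)) \<in> W"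
    unfolding nu_quadratic[OF k vC, symmetric]
    by (intro nu_stableD[OF W(1)] v k ground_intros)
  then have "lk_scale (inverse (m * eps k v)) (lk_scale (m * eps k v) (lk_w k (Suc k))) \<in> W"
    by (rule nu_stableD(4)[OF W(1) ground_inverse[OF F]])
  moreover have "inverse (m * eps k v) * (m * eps k v) = 1"
    by (rule left_inverse) (use nz m_nz in simp)
  ultimately have "lk_w k (Suc k) \<in> W" by (simp only: lk_scale_scale lk_scale_one)
  then show False using nu_stable_eq_carrier[OF W(1) k] W(2) by blast
qed

section \<open>Stable subspaces on which \<open>nu_1\<close> acts as \<open>r\<close>\<close>

text \<open>If \<open>nu_k = r\<close> on \<open>W\<close>, the braid relation applied to
  \<open>v\<close> with \<open>z = nu_{k+1} v\<close> reads \<open>r^2 z = r nu_{k+1} z\<close>.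
  Hence \<open>nu_{k+1} z = nu_{k+1} (r v)\<close>, and injectivity gives
  \<open>z = r v\<close>.\<close>

lemma trivial_action:
  assumes W: "nu_stable W" and "n \<ge> 3" and 1: "\<And>v. v \<in> W \<Longrightarrow> nu l r 1 v = lk_scale r v"
  shows "1 \<le> k \<Longrightarrow> k < n \<Longrightarrow> v \<in> W \<Longrightarrow> nu l r k v = lk_scale r v"
proof (induction k arbitrary: v rule: nat_induct_at_least)
  case base then show ?case by (intro 1)
next
  case (Suc k)
  have kn: "k < n" using Suc.prems by simp
  have k1: "1 \<le> Suc k" by simp
  have vC: "v \<in> lk_carrier n l r" by (rule nu_stableD(1)[OF W Suc.prems(2)])
  define z where "z = nu l r (Suc k) v"
  have z: "z \<in> W" unfolding z_def by (intro nu_stableD(5)[OF W] k1 Suc.prems)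
  have zC: "z \<in> lk_carrier n l r" by (rule nu_stableD(1)[OF W z])
  note IH = Suc.IH[OF kn]
  have "nu l r k (nu l r (Suc k) (nu l r k v)) = lk_scale r (lk_scale r z)"
    by (simp add: IH[OF Suc.prems(2)] nu_scale z_def[symmetric] IH[OF z])
  moreover have "nu l r (Suc k) (nu l r k (nu l r (Suc k) v)) = lk_scale r (nu l r (Suc k) z)"
    by (simp add: z_def[symmetric] IH[OF z] nu_scale)
  ultimately have "lk_scale r (lk_scale r z) = lk_scale r (nu l r (Suc k) z)"
    using nu_braid[OF Suc.hyps Suc.prems(1) vC] by simp
  then have "lk_scale (inverse r) (lk_scale r (lk_scale r z)) = lk_scale (inverse r) (lk_scale r (nu l r (Suc k) z))"
    by simp
  then have "lk_scale r z = nu l r (Suc k) z"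
    unfolding lk_scale_scale[of "inverse r"] using r by (simp add: lk_scale_one)
  then have "nu l r (Suc k) z = nu l r (Suc k) (lk_scale r v)" by (simp add: nu_scale z_def)
  then have "nu_inv (Suc k) (nu l r (Suc k) z) = nu_inv (Suc k) (nu l r (Suc k) (lk_scale r v))" by simp
  then show ?case
    unfolding nu_inv_left[OF k1 Suc.prems(1) zC] nu_inv_left[OF k1 Suc.prems(1) lk_carrier_scale[OF ground_r vC]]
    unfolding z_def .
qed

text \<open>The local entries of \<open>nu_k v = r v\<close> propagate \<open>a_12\<close> along
  rows and columns, so \<open>v\<close> is a nonzero multiple of \<open>sum r^{i+j} w_{ij}\<close>.
  The entry \<open>(1, 2)\<close> of \<open>nu_1 v = r v\<close>, with the geometric sum in
  \<open>f_2\<close> evaluated, then leaves \<open>1 / l = r^{2n-3}\<close>.\<close>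

lemma trivial_action_imp:
  assumes W: "nu_stable W" and n: "n \<ge> 3" and 1: "\<And>v. v \<in> W \<Longrightarrow> nu l r 1 v = lk_scale r v"
    and v: "v \<in> W" "v \<noteq> 0"
  shows "l = 1 / r ^ (2 * n - 3)"
proof -
  have vC: "v \<in> lk_carrier n l r" by (rule nu_stableD(1)[OF W v(1)])
  define a where "a = (\<lambda>i j. Poly_Mapping.lookup v (i, j))"
  have act: "nu l r k v = lk_scale r v" if "1 \<le> k" "k < n" for k
    using trivial_action[OF W n 1] that v(1) by blast
  have row: "a 1 (Suc (Suc j)) = r ^ j * a 1 2" if "Suc (Suc j) \<le> n" for j
    using that
  proof (induction j)
    case 0 then show ?case by (simp add: numeral_2_eq_2)
  next
    case (Suc j)
    have k: "1 \<le> Suc (Suc j)" "Suc (Suc j) < n" using Suc.prems by auto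
    have "Poly_Mapping.lookup (nu l r (Suc (Suc j)) v) (1, Suc (Suc j)) = a 1 (Suc (Suc (Suc j)))"
      using lookup_nu_simps(7)[OF k vC, of 1] by (simp add: a_def)
    then have "a 1 (Suc (Suc (Suc j))) = r * a 1 (Suc (Suc j))" using act[OF k] by (simp add: a_def)
    then show ?case using Suc by simp
  qed
  have col: "a i j = r ^ (i - 1) * a 1 j" if "1 \<le> i" "i < j" "j \<le> n" for i j
    using that
  proof (induction i rule: nat_induct_at_least)
    case (Suc i)
    have k: "i < n" using Suc.prems by auto
    have "Poly_Mapping.lookup (nu l r i v) (i, j) = a (Suc i) j"
      using lookup_nu_simps(5)[OF Suc.hyps k vC Suc.prems] by (simp add: a_def)
    then have "a (Suc i) j = r * a i j" using act[OF Suc.hyps k] by (simp add: a_def)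
    moreover have "r ^ (Suc i - 1) = r * r ^ (i - 1)" using Suc.hyps by (cases i) simp_all
    ultimately show ?case using Suc by simp
  qed simp
  have a12: "a 1 2 \<noteq> 0"
  proof
    assume 0: "a 1 2 = 0"
    have "Poly_Mapping.lookup v (i, j) = Poly_Mapping.lookup 0 (i, j)" if "1 \<le> i" "i < j" "j \<le> n" for i j
    proof -
      have "Suc (Suc (j - 2)) = j" using that by auto
      then have "a 1 j = 0" using row[of "j - 2"] that 0 by simp
      then show ?thesis using col[OF that] by (simp add: a_def)
    qed
    then have "v = 0" by (intro lk_carrier_eqI vC lk_carrier_zero)
    then show False using v by simp
  qed
  have fs: "fsum 2 v = a 1 2 * ((\<Sum>j\<in>{2<..n}. r ^ (2 * j)) / r + r ^ 4 / l)"
  proof -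
    have "r ^ j * a 2 j = a 1 2 / r * r ^ (2 * j)" if "j \<in> {2<..n}" for j
    proof -
      have "j = Suc (Suc (j - 2))" using that by auto
      then have "a 1 j = r ^ (j - 2) * a 1 2" "r ^ j = r * r * r ^ (j - 2)"
        using row[of "j - 2"] that by (metis greaterThanAtMost_iff, metis power_Suc mult.assoc)
      moreover have "a 2 j = r * a 1 j" using col[of 2 j] that by simp
      ultimately show ?thesis using r unfolding power_double by (simp add: mult_ac)
    qed
    then have "(\<Sum>j\<in>{2<..n}. r ^ j * a 2 j) = a 1 2 / r * (\<Sum>j\<in>{2<..n}. r ^ (2 * j))"
      by (simp add: sum_distrib_left)
    moreover have "{1..<2} = {1::nat}" by auto
    moreover have "Poly_Mapping.lookup v (i, j) = a i j" for i j by (simp add: a_def)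
    ultimately show ?thesis
      unfolding fsum_def by (simp add: algebra_simps eval_nat_numeral)
  qed
  have "r ^ (2 * n + 1) = r ^ (2 * n - 3) * r ^ 4" using n by (simp flip: power_add)
  then have mS: "m * (\<Sum>j\<in>{2<..n}. r ^ (2 * j)) = r ^ 5 - r ^ (2 * n - 3) * r ^ 4"
    using geometric_sum[of 2 n] n by simp
  have k: "1 \<le> (1::nat)" "1 < n" using n by simp_all
  have "r\<^sup>2 / l * a 1 2 + m / r ^ 3 * fsum 2 v = r * a 1 2"
    using lookup_nu_simps(4)[OF k vC] act[OF k] by (simp add: a_def numeral_2_eq_2[symmetric])
  then have "a 1 2 * (r\<^sup>2 / l + (m * (\<Sum>j\<in>{2<..n}. r ^ (2 * j)) / r + m * r ^ 4 / l) / r ^ 3 - r) = 0"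
    unfolding fs by (simp add: algebra_simps add_divide_distrib)
  then have 1: "r\<^sup>2 / l + ((r ^ 5 - r ^ (2 * n - 3) * r ^ 4) / r + m * r ^ 4 / l) / r ^ 3 - r = 0"
    using a12 unfolding mS by simp
  have 2: "((r ^ 5 - r ^ (2 * n - 3) * r ^ 4) / r + m * r ^ 4 / l) / r ^ 3 = r - r ^ (2 * n - 3) + m * r / l"
    using r by (simp add: diff_divide_distrib add_divide_distrib eval_nat_numeral)
  have 3: "r\<^sup>2 / l + m * r / l = 1 / l"
    by (simp add: m_r flip: add_divide_distrib)
  have "x = y" if "x1 + (z - y + x2) - z = 0" "x1 + x2 = x" for x x1 x2 y z :: complex
    using that by (simp add: algebra_simps)
  from this[OF 1[unfolded 2] 3] have "1 / l = r ^ (2 * n - 3)" .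
  then show ?thesis using l r by (simp add: field_simps)
qed

text \<open>The vectors supported on the pairs meeting $\{1, 2\}$ whose first two rows are those of a vector in
  the $(-1/r)$-eigenspace of $\nu_1$; the entry at $(1, 2)$ is free.\<close>

definition alternating_12 :: "lk_vec \<Rightarrow> bool" where
  "alternating_12 u \<longleftrightarrow> u \<in> lk_carrier n l r \<and>
     (\<forall>j. 2 < j \<longrightarrow> j \<le> n \<longrightarrow> Poly_Mapping.lookup u (2, j) = - Poly_Mapping.lookup u (1, j) / r) \<and>
     (\<forall>i j. 2 < i \<longrightarrow> i < j \<longrightarrow> j \<le> n \<longrightarrow> Poly_Mapping.lookup u (i, j) = 0)"

text \<open>Formally the product \<open>(w_1 - w_2 / r)(w_j - w_{j+1} / r)\<close>. For
  \<open>2 < j < n\<close> it is an eigenvector of both \<open>nu_1\<close> and \<open>nu_j\<close>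
  with eigenvalue \<open>-1/r\<close>.\<close>

definition square_vec :: "nat \<Rightarrow> lk_vec" where
  "square_vec j = lk_w 1 j - lk_scale (1 / r) (lk_w 1 (Suc j)) - lk_scale (1 / r) (lk_w 2 j)
     + lk_scale (1 / r\<^sup>2) (lk_w 2 (Suc j))"

lemma square_vec_carrier: "2 < j \<Longrightarrow> j < n \<Longrightarrow> square_vec j \<in> lk_carrier n l r"
  unfolding square_vec_def
  by (intro lk_carrier_add lk_carrier_diff lk_carrier_scale lk_carrier_w ground_intros) auto

lemma lookup_square_vec:
  "Poly_Mapping.lookup (square_vec j) (p, q) =
    (if p = 1 then if q = j then 1 else if q = Suc j then - 1 / r else 0
     else if p = 2 then if q = j then - 1 / r else if q = Suc j then 1 / r\<^sup>2 else 0 else 0)"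
  by (auto simp: square_vec_def lookup_add lookup_minus lookup_lk_w)

lemma alternating_square_vec: "2 < j \<Longrightarrow> j < n \<Longrightarrow> alternating_12 (square_vec j)"
  unfolding alternating_12_def
  by (auto simp: square_vec_carrier lookup_square_vec power2_eq_square)

text \<open>Column \<open>j\<close> has only the entries \<open>a_{1j}\<close> and
  \<open>a_{2j} = -a_{1j} / r\<close>, whose weighted sum \<open>r a_{1j} + r^2 a_{2j}\<close>
  vanishes. Hence \<open>nu_j\<close> creates no entry at \<open>(j, j+1)\<close>.\<close>

lemma alternating_fsum:
  assumes u: "alternating_12 u" and j: "2 < j" "j \<le> n"
  shows "fsum j u = 0"
proof -
  have "{1..<j} = {1, 2} \<union> {2<..<j}" using j by auto
  then have "(\<Sum>i\<in>{1..<j}. r ^ i * Poly_Mapping.lookup u (i, j)) =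
      (\<Sum>i\<in>{1, 2}. r ^ i * Poly_Mapping.lookup u (i, j)) + (\<Sum>i\<in>{2<..<j}. r ^ i * Poly_Mapping.lookup u (i, j))"
    by (simp only:) (rule sum.union_disjoint, auto)
  also have "(\<Sum>i\<in>{2<..<j}. r ^ i * Poly_Mapping.lookup u (i, j)) = 0"
    using u j by (intro sum.neutral) (auto simp: alternating_12_def)
  also have "(\<Sum>i\<in>{1, 2}. r ^ i * Poly_Mapping.lookup u (i, j)) = 0"
    using u j r by (simp add: alternating_12_def power2_eq_square)
  finally have "(\<Sum>i\<in>{1..<j}. r ^ i * Poly_Mapping.lookup u (i, j)) = 0" by simp
  moreover have "(\<Sum>i\<in>{j<..n}. r ^ i * Poly_Mapping.lookup u (j, i)) = 0"
    using u j by (intro sum.neutral) (auto simp: alternating_12_def)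
  ultimately show ?thesis by (simp add: fsum_def)
qed

text \<open>On the entries \<open>(x, y)\<close> of a row in columns \<open>j\<close> and
  \<open>j+1\<close>, \<open>nu_j - r\<close> gives \<open>(y - r x, x - y / r)\<close>, which is
  \<open>y - r x\<close> times \<open>(1, -1/r)\<close>. The second row is \<open>-1/r\<close> times
  the first, which yields the shape of \<open>square_vec\<close>.\<close>

lemma nu_alternating:
  assumes u: "alternating_12 u" and j: "2 < j" "j < n"
  shows "nu l r j u - lk_scale r u =
    lk_scale (Poly_Mapping.lookup u (1, Suc j) - r * Poly_Mapping.lookup u (1, j)) (square_vec j)"
proof -
  define b where "b = (\<lambda>j. Poly_Mapping.lookup u (1, j))"
  have uC: "u \<in> lk_carrier n l r" using u by (simp add: alternating_12_def)
  have j1: "1 \<le> j" using j by simp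
  have b1: "Poly_Mapping.lookup u (1, q) = b q" for q by (simp add: b_def)
  have b2: "2 < q \<Longrightarrow> q \<le> n \<Longrightarrow> Poly_Mapping.lookup u (2, q) = - b q / r" for q
    using u by (simp add: alternating_12_def b_def)
  have b3: "2 < p \<Longrightarrow> p < q \<Longrightarrow> q \<le> n \<Longrightarrow> Poly_Mapping.lookup u (p, q) = 0" for p q
    using u by (simp add: alternating_12_def)
  have rm: "y - m * z - r * z = y - z / r" for y z
    using r by (simp add: bmw_m_def algebra_simps)
  have "Poly_Mapping.lookup (nu l r j u - lk_scale r u) (p, q) =
      Poly_Mapping.lookup (lk_scale (b (Suc j) - r * b j) (square_vec j)) (p, q)"
    if pq: "1 \<le> p" "p < q" "q \<le> n" for p q
  proof -
    consider "p = 1 \<or> p = 2" | "2 < p" using pq by linarith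
    then show ?thesis
    proof cases
      case 1
      then have p: "p < j" using j by auto
      consider "q < j" | "q = j" | "q = Suc j" | "Suc j < q" by linarith
      then show ?thesis
      proof cases
        case A: 1
        have "Poly_Mapping.lookup (nu l r j u) (p, q) = r * Poly_Mapping.lookup u (p, q)"
          using A pq by (intro lookup_nu_simps(1)[OF j1 j(2) uC])
        then show ?thesis using 1 A by (auto simp: lookup_minus lookup_square_vec)
      next
        case A: 2
        have "Poly_Mapping.lookup (nu l r j u) (p, q) = Poly_Mapping.lookup u (p, Suc j)"
          unfolding A by (intro lookup_nu_simps(7)[OF j1 j(2) uC] pq p)
        then show ?thesis
          using 1 A j r by (auto simp: lookup_minus lookup_square_vec b1 b1[unfolded One_nat_def] b2 field_simps)
      next
        case A: 3
        have "Poly_Mapping.lookup (nu l r j u) (p, q) = Poly_Mapping.lookup u (p, j) - m * Poly_Mapping.lookup u (p, Suc j)"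
          unfolding A by (intro lookup_nu_simps(8)[OF j1 j(2) uC] pq p)
        then have *: "Poly_Mapping.lookup (nu l r j u - lk_scale r u) (p, q) =
            Poly_Mapping.lookup u (p, j) - Poly_Mapping.lookup u (p, Suc j) / r"
          by (simp add: lookup_minus A rm)
        show ?thesis
          unfolding * using 1 A j r by (auto simp: lookup_square_vec b1 b1[unfolded One_nat_def] b2 field_simps power2_eq_square)
      next
        case A: 4
        have "Poly_Mapping.lookup (nu l r j u) (p, q) = r * Poly_Mapping.lookup u (p, q)"
          using A pq p by (intro lookup_nu_simps(2)[OF j1 j(2) uC])
        then show ?thesis using 1 A by (auto simp: lookup_minus lookup_square_vec)
      qed
    next
      case 2
      have f: "fsum (Suc j) u = 0" using j by (intro alternating_fsum[OF u]) auto
      have j': "j \<le> n" "2 < Suc j" "Suc j \<le> n" "Suc j < q \<Longrightarrow> j < q" "p < j \<Longrightarrow> p < Suc j" using j by simp_all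
      from pq(2) have "Poly_Mapping.lookup (nu l r j u) (p, q) = 0"
        by (cases rule: pair_order_cases[where k = j])
          (simp only: lookup_nu_simps[OF j1 j(2) uC] b3 f j j' pq 2 lessI mult_zero_right diff_0_right add_0)+
      then show ?thesis using 2 pq by (simp add: lookup_minus lookup_square_vec b3)
    qed
  qed
  moreover have "b (Suc j) - r * b j \<in> ground_set l r"
    using uC unfolding b_def lk_carrier_iff by (intro ground_intros) blast+
  ultimately show ?thesis
    unfolding b_def using j1 j uC
    by (intro lk_carrier_eqI lk_carrier_diff lk_carrier_scale lk_carrier_nu square_vec_carrier ground_r)
qed

lemma square_vec_imp:
  assumes W: "nu_stable W" "W \<noteq> lk_carrier n l r" and j: "2 < j" "j < n" and y: "square_vec j \<in> W"
  shows "l = r \<or> l = - (r ^ 3)"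
proof -
  have down: "3 \<le> j \<Longrightarrow> j < n \<Longrightarrow> square_vec j \<in> W \<Longrightarrow> square_vec 3 \<in> W" for j
  proof (induction j rule: nat_induct_at_least)
    case (Suc j)
    have j: "2 < Suc j" "2 < j" "j < n" "1 \<le> j" using Suc.hyps Suc.prems by auto
    \<comment> \<open>The multiplier supplied by \<open>nu_alternating\<close> is 1:
      \<open>square_vec (Suc j)\<close> has entry 1 at \<open>(1, j+1)\<close> and 0 at
      \<open>(1, j)\<close>.\<close>
    have "nu l r j (square_vec (Suc j)) - lk_scale r (square_vec (Suc j)) = square_vec j"
      using nu_alternating[OF alternating_square_vec[OF j(1) Suc.prems(1)] j(2,3)]
      by (simp add: lookup_square_vec lk_scale_one)
    moreover have "nu l r j (square_vec (Suc j)) - lk_scale r (square_vec (Suc j)) \<in> W"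
      by (intro nu_stableD[OF W(1)] Suc.prems j ground_r)
    ultimately show ?case using Suc.IH j by simp
  qed
  have y3: "square_vec 3 \<in> W" by (rule down[OF _ j(2) y]) (use j in simp)
  have n: "4 \<le> n" using j by simp
  have "eps 2 (square_vec 3) = 0"
    using n by (intro eps_eq_0_of_proper[OF W _ _ y3]) auto
  moreover have "eps 2 (lk_w 1 3) = 1 / l\<^sup>2" "eps 2 (lk_w 1 4) = 0" "eps 2 (lk_w 2 4) = 1"
      "eps 2 (lk_w 2 3) = (1 / l\<^sup>2 + m / l - 1) / m"
    using n r eps_w[of 2] by (simp_all add: eval_nat_numeral)
  ultimately have "1 / l\<^sup>2 - (1 / l\<^sup>2 + m / l - 1) / m / r + 1 / r\<^sup>2 = 0"
    unfolding square_vec_def by (simp add: eps_linear eval_nat_numeral)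
  then have 1: "m * l\<^sup>2 * r\<^sup>2 * (1 / l\<^sup>2 - (1 / l\<^sup>2 + m / l - 1) / m / r + 1 / r\<^sup>2) = 0"
    by (simp only: mult_zero_right)
  have 2: "m * l\<^sup>2 * r\<^sup>2 * (1 / l\<^sup>2 - g / m / r + 1 / r\<^sup>2) = (m * r) * r - r * (l\<^sup>2 * g) + m * l\<^sup>2" for g
    using l r m_nz by (simp add: distrib_left right_diff_distrib power2_eq_square)
  have 3: "l\<^sup>2 * (1 / l\<^sup>2 + m / l - 1) = 1 + m * l - l\<^sup>2"
    using l by (simp add: distrib_left right_diff_distrib power2_eq_square)
  \<comment> \<open>The extra factor \<open>r\<close> makes every \<open>m\<close> occur as
    \<open>m r\<close>, which \<open>m_r\<close> replaces by \<open>1 - r^2\<close>.\<close>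
  have 4: "r * ((m * r) * r - r * (1 + m * l - l\<^sup>2) + m * l\<^sup>2) = 0"
    using 1 unfolding 2 3 by (simp only: mult_zero_right)
  have 5: "r * ((m * r) * r - r * (1 + m * l - l\<^sup>2) + m * l\<^sup>2) =
      (m * r) * r\<^sup>2 - r\<^sup>2 - r * l * (m * r) + r\<^sup>2 * l\<^sup>2 + (m * r) * l\<^sup>2"
    by (simp add: algebra_simps power2_eq_square)
  have "(l - r) * (l + r ^ 3) = 0"
    using 4 unfolding 5 unfolding m_r by (simp add: algebra_simps power2_eq_square power3_eq_cube)
  then show ?thesis by (auto simp: eq_neg_iff_add_eq_0)
qed

text \<open>By \<open>geom\<close> the vector \<open>u\<close> depends only on
  \<open>b = a_13\<close> and \<open>d = a_12\<close>. Two linear equations in \<open>b\<close> and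
  \<open>d\<close> are available: \<open>E1\<close> is the entry \<open>(1, 2)\<close> of
  \<open>nu_1 u = -u / r\<close>, and \<open>E2\<close> is \<open>eps_2 u = 0\<close>. Eliminating
  \<open>d\<close> leaves \<open>b\<close> times a polynomial in \<open>1 / l\<close>, whose two
  factors are the alternatives.\<close>

lemma alternating_imp:
  assumes W: "nu_stable W" "W \<noteq> lk_carrier n l r" and n: "3 \<le> n"
    and u: "u \<in> W" "u \<noteq> 0" "alternating_12 u" and nu1: "nu l r 1 u = lk_scale (- 1 / r) u"
    and geom: "\<And>j. 2 < j \<Longrightarrow> j < n \<Longrightarrow> Poly_Mapping.lookup u (1, Suc j) = r * Poly_Mapping.lookup u (1, j)"
  shows "l = - (r ^ 3) \<or> l\<^sup>2 * r ^ (2 * n - 2) = r ^ 4"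
proof -
  define b d where "b = Poly_Mapping.lookup u (1, 3)" and "d = Poly_Mapping.lookup u (1, 2)"
  have uC: "u \<in> lk_carrier n l r" using u(3) by (simp add: alternating_12_def)
  have row: "r ^ 3 * Poly_Mapping.lookup u (1, j) = r ^ j * b" if "3 \<le> j" "j \<le> n" for j
    using that
  proof (induction j rule: nat_induct_at_least)
    case (Suc j)
    then show ?case using geom[of j] by (simp add: mult_ac)
  qed (simp add: b_def)
  define s where "s = (\<Sum>j\<in>{2<..n}. r ^ (2 * j))"
  have f2: "fsum 2 u = - (b * s / r ^ 4) + r ^ 4 / l * d"
  proof -
    have "r ^ j * Poly_Mapping.lookup u (2, j) = - (b / r ^ 4) * r ^ (2 * j)" if "j \<in> {2<..n}" for j
    proof -
      have "Poly_Mapping.lookup u (1, j) = r ^ j * b / r ^ 3" using row[of j] that r by (simp add: field_simps)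
      moreover have "Poly_Mapping.lookup u (2, j) = - Poly_Mapping.lookup u (1, j) / r"
        using u(3) that by (simp add: alternating_12_def)
      ultimately show ?thesis unfolding power_double using r by (simp add: eval_nat_numeral mult_ac)
    qed
    then have "(\<Sum>j\<in>{2<..n}. r ^ j * Poly_Mapping.lookup u (2, j)) = - (b / r ^ 4) * s"
      by (simp add: s_def sum_distrib_left)
    moreover have "{1..<2} = {1::nat}" by auto
    ultimately show ?thesis unfolding fsum_def by (simp add: d_def eval_nat_numeral)
  qed
  have n1: "1 \<le> (1::nat)" "1 < n" "1 \<le> (2::nat)" "2 < n" using n by simp_all
  have p: "r ^ (2 * n + 1) = r ^ (2 * n - 2) * r ^ 3" using n by (simp flip: power_add)
  have ms: "m * s = r ^ 5 - r ^ (2 * n - 2) * r ^ 3"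
    unfolding s_def using geometric_sum[of 2 n] n p by simp
  have "r\<^sup>2 / l * d + m / r ^ 3 * fsum 2 u = - d / r"
    using lookup_nu_simps(4)[OF n1(1,2) uC] nu1 by (simp add: d_def numeral_2_eq_2[symmetric])
  moreover have "r\<^sup>2 / l * d + m / r ^ 3 * (- (b * s / r ^ 4) + r ^ 4 / l * d) = d / l - b * (m * s) / r ^ 7"
  proof -
    have "r\<^sup>2 / l * d + m / r ^ 3 * (- (b * s / r ^ 4) + r ^ 4 / l * d) = (r\<^sup>2 + m * r) / l * d - b * (m * s) / r ^ 7"
      using r by (simp add: algebra_simps add_divide_distrib eval_nat_numeral)
    then show ?thesis by (simp add: m_r)
  qed
  ultimately have E1: "d * (1 / l + 1 / r) = b * (m * s) / r ^ 7"
    unfolding f2 by (simp add: algebra_simps)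
  have "eps 2 u = 0" by (rule eps_eq_0_of_proper[OF W n1(3,4) u(1)])
  moreover have "fsum 3 u = 0" using n by (intro alternating_fsum[OF u(3)]) auto
  moreover have "Poly_Mapping.lookup u (2, 3) = - b / r" using u(3) n by (simp add: alternating_12_def b_def)
  ultimately have E2: "(- (b * s / r ^ 4) + r ^ 4 / l * d) / r ^ 4
      - b / r * ((1 / l\<^sup>2 + m / l - 1) / m - 1 / r - r / l\<^sup>2) = 0"
    by (simp add: eps_def f2 numeral_2_eq_2[symmetric] numeral_3_eq_3[symmetric])
  \<comment> \<open>For \<open>b = 0\<close> equation \<open>E2\<close> reduces to
    \<open>d / l = 0\<close>, and then all coordinates of \<open>u\<close> vanish.\<close>
  have "b \<noteq> 0"
  proof
    assume b: "b = 0"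
    then have d: "d = 0" using E2 r l by simp
    have "Poly_Mapping.lookup u (i, j) = Poly_Mapping.lookup 0 (i, j)" if ij: "1 \<le> i" "i < j" "j \<le> n" for i j
    proof -
      have one: "Poly_Mapping.lookup u (1, j) = 0" if "2 < j" "j \<le> n" for j
        using row[of j] that b r by simp
      consider "i = 1" "j = 2" | "i = 1" "2 < j" | "i = 2" | "2 < i" using ij by linarith
      then show ?thesis using u(3) ij d one by cases (simp_all add: alternating_12_def d_def)
    qed
    then have "u = 0" by (intro lk_carrier_eqI uC lk_carrier_zero)
    with u(2) show False ..
  qed
  define x P where "x = 1 / l" and "P = r ^ (2 * n - 2)"
  have xl: "1 / l\<^sup>2 = x\<^sup>2" "m / l = m * x" "r / l\<^sup>2 = r * x\<^sup>2" "r ^ 4 / l = r ^ 4 * x" "1 / l = x"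
    by (simp_all add: x_def power_divide)
  define e where "e = (- (b * s / r ^ 4) + r ^ 4 * x * d) / r ^ 4 - b / r * ((x\<^sup>2 + m * x - 1) / m - 1 / r - r * x\<^sup>2)"
  have e0: "e = 0" using E2 unfolding xl e_def by simp
  define q where "q = r\<^sup>2 - P"
  have ms': "m * s = r ^ 3 * q" unfolding ms q_def P_def[symmetric] by (simp add: algebra_simps eval_nat_numeral)
  have E1': "(x + 1 / r) * d = b * q / r ^ 4"
    using E1 r unfolding xl ms' by (simp add: eval_nat_numeral mult_ac)
  have "m * e = - (b * (m * s) / r ^ 8) + m * x * d - b / r * (m * ((x\<^sup>2 + m * x - 1) / m - 1 / r - r * x\<^sup>2))"
    using r unfolding e_def by (simp add: algebra_simps diff_divide_distrib add_divide_distrib eval_nat_numeral)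
  also have "m * ((x\<^sup>2 + m * x - 1) / m - 1 / r - r * x\<^sup>2) = r\<^sup>2 * x\<^sup>2 + (1 / r - r) * x - 1 / r\<^sup>2"
  proof -
    have "m * ((x\<^sup>2 + m * x - 1) / m - 1 / r - r * x\<^sup>2) = (x\<^sup>2 + m * x - 1) - m / r - (m * r) * x\<^sup>2"
      using m_nz by (simp add: right_diff_distrib)
    also have "m / r = 1 / r\<^sup>2 - 1" using r by (simp add: bmw_m_def diff_divide_distrib power2_eq_square)
    finally show ?thesis unfolding m_r by (simp add: bmw_m_def algebra_simps)
  qed
  finally have me: "m * e = - (b * q / r ^ 5) + m * x * d - b / r * (r\<^sup>2 * x\<^sup>2 + (1 / r - r) * x - 1 / r\<^sup>2)"
    unfolding ms' using r by (simp add: eval_nat_numeral)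
  have expand: "c1 * c2 * (- t1 + m * x * d - t2) = - (c1 * c2 * t1) + c1 * m * x * (c2 * d) - c1 * c2 * t2"
    for c1 c2 t1 t2 by (simp add: algebra_simps)
  \<comment> \<open>\<open>E2\<close> is multiplied by the coefficient \<open>x + 1 / r\<close> of
    \<open>d\<close> in \<open>E1'\<close>, and that product with \<open>d\<close> is then replaced.
    No division by \<open>x + 1 / r\<close> takes place, which would fail for
    \<open>l = -r\<close>.\<close>
  have "0 = r ^ 6 * (x + 1 / r) * (m * e)" by (simp add: e0)
  also have "\<dots> = - (r ^ 6 * (x + 1 / r) * (b * q / r ^ 5)) + r ^ 6 * m * x * ((x + 1 / r) * d)
      - r ^ 6 * (x + 1 / r) * (b / r * (r\<^sup>2 * x\<^sup>2 + (1 / r - r) * x - 1 / r\<^sup>2))"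
    unfolding me by (rule expand)
  also have "r ^ 6 * (x + 1 / r) * (b * q / r ^ 5) = (r * x + 1) * (b * q)"
    using r by (simp add: algebra_simps eval_nat_numeral)
  also have "r ^ 6 * m * x * ((x + 1 / r) * d) = (r - r ^ 3) * x * (b * q)"
    unfolding E1' using r by (simp add: bmw_m_def algebra_simps eval_nat_numeral)
  also have "r ^ 6 * (x + 1 / r) * (b / r * (r\<^sup>2 * x\<^sup>2 + (1 / r - r) * x - 1 / r\<^sup>2)) =
      (r * x + 1) * (b * (r ^ 6 * x\<^sup>2 + (r ^ 3 - r ^ 5) * x - r\<^sup>2))"
    using r by (simp add: algebra_simps eval_nat_numeral)
  also have "- ((r * x + 1) * (b * q)) + (r - r ^ 3) * x * (b * q)
      - (r * x + 1) * (b * (r ^ 6 * x\<^sup>2 + (r ^ 3 - r ^ 5) * x - r\<^sup>2)) = b * ((1 + r ^ 3 * x) * (P - r ^ 4 * x\<^sup>2))"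
    unfolding q_def by (simp add: algebra_simps eval_nat_numeral)
  finally have "(1 + r ^ 3 * x) * (P - r ^ 4 * x\<^sup>2) = 0" using \<open>b \<noteq> 0\<close> by simp
  then consider "1 + r ^ 3 * x = 0" | "P - r ^ 4 * x\<^sup>2 = 0" by auto
  then show ?thesis
  proof cases
    case 1
    then have "l * (1 + r ^ 3 * x) = 0" by simp
    then have "l + r ^ 3 = 0" using l by (simp add: x_def distrib_left)
    then show ?thesis by (simp add: eq_neg_iff_add_eq_0)
  next
    case 2
    then have "l\<^sup>2 * P = r ^ 4" using l by (simp add: x_def power_divide)
    then show ?thesis by (simp add: P_def)
  qed
qed

section \<open>The case distinction for a proper nonzero stable subspace\<close>

lemma reducible_imp:
  assumes n: "3 \<le> n" and red: "\<not> lk_irreducible n l r"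
  shows "l = 1 / r ^ (2 * n - 3) \<or> l = - (r ^ 3) \<or> l\<^sup>2 * r ^ (2 * n - 2) = r ^ 4 \<or> (4 \<le> n \<and> l = r)"
proof -
  obtain W where W: "nu_stable W" "W \<noteq> {0}" "W \<noteq> lk_carrier n l r"
    using red unfolding lk_irreducible_iff by blast
  have n1: "1 \<le> (1::nat)" "1 < n" using n by simp_all
  show ?thesis
  proof (cases "\<forall>v\<in>W. nu l r 1 v = lk_scale r v")
    case True
    obtain v where "v \<in> W" "v \<noteq> 0" using W(2) nu_stableD(2)[OF W(1)] by blast
    then show ?thesis using trivial_action_imp[OF W(1) n, of v] True by blast
  next
    case False
    then obtain v where v: "v \<in> W" "nu l r 1 v \<noteq> lk_scale r v" by blast
    have vC: "v \<in> lk_carrier n l r" by (rule nu_stableD(1)[OF W(1) v(1)])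
    define u where "u = nu l r 1 v - lk_scale r v"
    have uW: "u \<in> W" unfolding u_def by (intro nu_stableD[OF W(1)] v n1 ground_r)
    have uC: "u \<in> lk_carrier n l r" by (rule nu_stableD(1)[OF W(1) uW])
    have u0: "u \<noteq> 0" using v(2) by (simp add: u_def)
    have rs: "m + r = 1 / r" by (simp add: bmw_m_def)
    have "Poly_Mapping.lookup u (2, j) = - Poly_Mapping.lookup u (1, j) / r" if "2 < j" "j \<le> n" for j
    proof -
      have "Poly_Mapping.lookup u (1, j) = Poly_Mapping.lookup v (2, j) - r * Poly_Mapping.lookup v (1, j)"
        using lookup_nu_simps(5)[OF n1 vC, of j] that by (simp add: u_def lookup_minus numeral_2_eq_2)
      moreover have "Poly_Mapping.lookup u (2, j) =
          Poly_Mapping.lookup v (1, j) - (m + r) * Poly_Mapping.lookup v (2, j)"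
        using lookup_nu_simps(6)[OF n1 vC, of j] that by (simp add: u_def lookup_minus numeral_2_eq_2 algebra_simps)
      ultimately show ?thesis unfolding rs using r by (simp only:) (simp add: field_simps)
    qed
    moreover have "Poly_Mapping.lookup u (i, j) = 0" if "2 < i" "i < j" "j \<le> n" for i j
      using lookup_nu_simps(3)[OF n1 vC, of i j] that by (simp add: u_def lookup_minus)
    ultimately have alt: "alternating_12 u" using uC by (simp add: alternating_12_def)
    \<comment> \<open>As \<open>eps_1 v = 0\<close>, the quadratic relation holds exactly on
      \<open>v\<close> and factors as \<open>(nu_1 + 1/r)(nu_1 - r) v = 0\<close>.\<close>
    have nu1: "nu l r 1 u = lk_scale (- 1 / r) u"
    proof -
      have "nu l r 1 (nu l r 1 v) + lk_scale m (nu l r 1 v) - v = 0"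
        unfolding nu_quadratic[OF n1 vC] eps_eq_0_of_proper[OF W(1,3) n1 v(1)] by (simp add: lk_scale_zero_left)
      then have "nu l r 1 (nu l r 1 v) = v - lk_scale m (nu l r 1 v)" by (simp add: algebra_simps)
      then have "nu l r 1 u = v - lk_scale (m + r) (nu l r 1 v)"
        by (simp add: u_def nu_diff nu_scale lk_scale_add_left algebra_simps)
      also have "\<dots> = lk_scale (- 1 / r) u"
        unfolding rs u_def using r
        by (intro poly_mapping_eqI) (simp add: lookup_minus field_simps)
      finally show ?thesis .
    qed
    show ?thesis
    proof (cases "\<exists>j. 2 < j \<and> j < n \<and> Poly_Mapping.lookup u (1, Suc j) \<noteq> r * Poly_Mapping.lookup u (1, j)")
      case True
      then obtain j where j: "2 < j" "j < n" and ne: "Poly_Mapping.lookup u (1, Suc j) - r * Poly_Mapping.lookup u (1, j) \<noteq> 0"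
        by auto
      let ?c = "Poly_Mapping.lookup u (1, Suc j) - r * Poly_Mapping.lookup u (1, j)"
      have j1: "1 \<le> j" using j by simp
      have c: "?c \<in> ground_set l r" using uC unfolding lk_carrier_iff by (intro ground_intros) blast+
      have "lk_scale ?c (square_vec j) \<in> W"
        unfolding nu_alternating[OF alt j, symmetric] by (intro nu_stableD[OF W(1)] uW j1 j(2) ground_r)
      then have "lk_scale (inverse ?c) (lk_scale ?c (square_vec j)) \<in> W"
        by (rule nu_stableD(4)[OF W(1) ground_inverse[OF c]])
      then have "square_vec j \<in> W" by (simp only: lk_scale_scale left_inverse[OF ne] lk_scale_one)
      then have "l = r \<or> l = - (r ^ 3)" by (rule square_vec_imp[OF W(1,3) j])
      \<comment> \<open>An index with \<open>2 < j < n\<close> exists only for \<open>n\<close> at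
        least 4; this is why \<open>l = r\<close> is not exceptional for
        \<open>n = 3\<close>.\<close>
      then show ?thesis using j by auto
    next
      case False
      then show ?thesis using alternating_imp[OF W(1,3) n uW u0 alt nu1] by blast
    qed
  qed
qed

end

theorem mainTheorem1:
  fixes n :: nat and l r :: complex
  assumes "n \<ge> 3"
    and "l \<noteq> 0" and "r \<noteq> 0"
    and "\<forall>k \<in> {1..n}. (r ^ 2) ^ k \<noteq> 1"
  shows "(n \<ge> 4 \<longrightarrow>
            (l \<notin> {r, - (r ^ 3), 1 / r ^ (n - 3), - (1 / r ^ (n - 3)), 1 / r ^ (2 * n - 3)}
               \<longrightarrow> lk_irreducible n l r) \<and>
            (l \<in> {r, - (r ^ 3), 1 / r ^ (n - 3), - (1 / r ^ (n - 3)), 1 / r ^ (2 * n - 3)}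
               \<longrightarrow> \<not> lk_irreducible n l r)) \<and>
         (n = 3 \<longrightarrow>
            (l \<notin> {- (r ^ 3), 1 / r ^ 3, 1, - 1} \<longrightarrow> lk_irreducible n l r) \<and>
            (l \<in> {- (r ^ 3), 1 / r ^ 3, 1, - 1} \<longrightarrow> \<not> lk_irreducible n l r))"
proof -
  have "(r ^ 2) ^ 1 \<noteq> 1" using assms(1,4) by (meson atLeastAtMost_iff le_trans one_le_numeral order_refl)
  then interpret lk_params n l r using assms by unfold_locales simp_all
  \<comment> \<open>In terms of \<open>p\<close> the condition \<open>l^2 r^{2n-2} = r^4\<close> is
    \<open>(l p)^2 = 1\<close>, which gives the two values \<open>1/p\<close> and
    \<open>-1/p\<close>.\<close>
  define p where "p = r ^ (n - 3)"
  have p0: "p \<noteq> 0" using r by (simp add: p_def)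
  have p2: "r ^ (2 * n) = p\<^sup>2 * r ^ 6" "r ^ (2 * n - 2) = p\<^sup>2 * r ^ 4"
  proof -
    have "2 * n = (n - 3) * 2 + 6" "2 * n - 2 = (n - 3) * 2 + 4" using assms(1) by simp_all
    then show "r ^ (2 * n) = p\<^sup>2 * r ^ 6" "r ^ (2 * n - 2) = p\<^sup>2 * r ^ 4"
      unfolding p_def by (metis power_add power_mult)+
  qed
  have "l\<^sup>2 * r ^ (2 * n - 2) = r ^ 4 \<longleftrightarrow> (l * p)\<^sup>2 = 1"
    unfolding p2 using r by (simp add: power_mult_distrib)
  also have "\<dots> \<longleftrightarrow> l = 1 / p \<or> l = - (1 / p)"
    by (simp only: power2_eq_1_iff minus_divide_left nonzero_eq_divide_eq[OF p0])
  finally have lp: "l\<^sup>2 * r ^ (2 * n - 2) = r ^ 4 \<longleftrightarrow> l = 1 / p \<or> l = - (1 / p)" .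
  have burau: "\<not> lk_irreducible n l r" if "l = 1 / p \<or> l = - (1 / p)"
  proof (rule reducible_burau)
    have "r ^ (2 * n) = r ^ (2 * n - 2) * r\<^sup>2" unfolding p2 by (simp flip: power_add)
    then have "l\<^sup>2 * r ^ (2 * n) = (l\<^sup>2 * r ^ (2 * n - 2)) * r\<^sup>2" by (simp only: mult.assoc)
    also have "\<dots> = r ^ 6" using lp that by (simp flip: power_add)
    finally show "l\<^sup>2 * r ^ (2 * n) = r ^ 6" .
  qed (use assms(1) in simp)
  have irr: "l = 1 / r ^ (2 * n - 3) \<or> l = - (r ^ 3) \<or> (l = 1 / p \<or> l = - (1 / p)) \<or> (4 \<le> n \<and> l = r)"
    if "\<not> lk_irreducible n l r"
    using reducible_imp[OF assms(1) that] unfolding lp .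
  have one_dim: "\<not> lk_irreducible n l r" if "l = 1 / r ^ (2 * n - 3)"
    by (rule reducible_one_dim[OF that assms(1)])
  \<comment> \<open>For \<open>n = 3\<close> the values \<open>1/p\<close> and \<open>-1/p\<close>
    become 1 and -1, and \<open>1 / r^{2n-3}\<close> becomes \<open>1 / r^3\<close>.\<close>
  have "p = 1" "r ^ (2 * n - 3) = r ^ 3" if "n = 3" using that by (simp_all add: p_def)
  note n3 = this
  show ?thesis unfolding p_def[symmetric]
  proof (intro conjI impI)
    show "lk_irreducible n l r"
      if "n \<ge> 4" "l \<notin> {r, - (r ^ 3), 1 / p, - (1 / p), 1 / r ^ (2 * n - 3)}"
      using irr that(2) by blast
    show "\<not> lk_irreducible n l r"
      if "n \<ge> 4" "l \<in> {r, - (r ^ 3), 1 / p, - (1 / p), 1 / r ^ (2 * n - 3)}"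
      using that(2) reducible_fsum[OF _ that(1)] burau one_dim by blast
    show "lk_irreducible n l r" if "n = 3" "l \<notin> {- (r ^ 3), 1 / r ^ 3, 1, - 1}"
    proof (rule ccontr)
      assume "\<not> lk_irreducible n l r"
      from irr[OF this] that(2) show False unfolding n3[OF that(1)] by (simp add: that(1))
    qed
    show "\<not> lk_irreducible n l r" if "n = 3" "l \<in> {- (r ^ 3), 1 / r ^ 3, 1, - 1}"
    proof -
      have "l = - (r ^ 3) \<or> l = 1 / r ^ 3 \<or> l = 1 \<or> l = - 1" using that(2) by blast
      then show ?thesis
        using reducible_fsum_3[OF _ that(1)] one_dim[unfolded n3(2)[OF that(1)]]
          burau[unfolded n3(1)[OF that(1)] div_by_1] by blast
    qed
  qed
qed

end
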